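(* Let $n\ge1$, $1\le\ell\le m-1$, and $$Q(\lambda,i\xi)=\sum_{j=0}^{\ell}P_{m-j}(\lambda,i\xi),$$ where $P_{m-j}(\partial_t,\partial_x)$ are homogeneous operators of degree $m-j$ on $\mathbb{R}_t\times\mathbb{R}^n_x$, with $c_{m,0}=1$ and $c_{m-\ell,0}>0$. Assume that $P_{m-\ell}(\partial_t,\partial_x)$ and $P_{m-\ell+1}(\partial_t,\partial_x)$ are strictly hyperbolic, and that $P_{m-\ell}(\lambda,\xi')$ and $P_{m-\ell+1}(\lambda,\xi')$ strictly interlace for any $\xi'\in S^{n-1}$. Then we may label the $m$ roots $\lambda_j(\xi)$ of $Q(\lambda,i\xi)=0$, $\xi\in\mathbb{R}^n$, in such a way that $\lambda_m(0),\ldots,\lambda_{m-\ell+1}(0)$ are the solutions of $$\sum_{j=0}^{\ell}c_{m-j,0}\lambda^{\ell-j}=0,$$ and $$\lambda_j(\xi)=i|\xi|\beta_j(\xi')+|\xi|^2\,\frac{P_{m-\ell+1}(\beta_j(\xi'),\xi')}{\check P_{m-\ell,j}(\beta_j(\xi'),\xi')}+o(|\xi|^2),\qquad j=1,\ldots,m-\ell,$$ as $\xi\to0$, where $\beta_j(\xi')$ are the $m-\ell$ real roots of $P_{m-\ell}(\lambda,\xi')$ and $\xi'=\xi/|\xi|\in S^{n-1}$.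
   Context: A homogeneous operator of order (degree) $r$ is $P_r(\partial_t,\partial_x)=\sum_{k+|\alpha|=r}c_{k,\alpha}\partial_t^k\partial_x^\alpha$ with constant coefficients; its symbol is $P_r(\lambda,\xi)=\sum_{k+|\alpha|=r}c_{k,\alpha}\lambda^k\xi^\alpha$, and $P_r(\lambda,i\xi)$ denotes the symbol with $\xi$ replaced by $i\xi$. It is strictly hyperbolic if $c_{r,0}>0$ and, for every $\xi'\in S^{n-1}=\{\xi\in\mathbb{R}^n:|\xi|=1\}$, the polynomial $\lambda\mapsto P_r(\lambda,\xi')$ has only real and distinct roots. If $p_{r-1}$, $p_r$ are polynomials of degree $r-1$, $r$ with real roots $\tilde\lambda_1\le\dots\le\tilde\lambda_{r-1}$ and $\lambda_1\le\dots\le\lambda_r$, they strictly interlace if $\lambda_1<\tilde\lambda_1<\lambda_2<\dots<\tilde\lambda_{r-1}<\lambda_r$. $\check P_{m-\ell,j}(\lambda,\xi')=P_{m-\ell}(\lambda,\xi')/(\lambda-\beta_j(\xi'))$ (a polynomial in $\lambda$). Roots are counted with multiplicity. *)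

theory Defs
  imports
    "HOL-Analysis.Analysis"
    "HOL-Computational_Algebra.Computational_Algebra"
    "HOL-Library.Landau_Symbols"
begin

text \<open>
  A constant-coefficient differential operator on the product of the time line and
  \<^typ>\<open>real ^ 'n\<close> is represented by its coefficients \<^term>\<open>c k \<alpha>\<close>, where \<^term>\<open>k\<close> is the
  order in time and the multi-index \<^term>\<open>\<alpha>\<close> the order in space.  Since the order
  of the homogeneous part to which \<^term>\<open>c k \<alpha>\<close> belongs is determined by \<^term>\<open>k\<close> and \<^term>\<open>\<alpha>\<close>,
  one coefficient family carries homogeneous operators of all orders simultaneously.
\<close>

type_synonym 'n coeffs = "nat \<Rightarrow> ('n \<Rightarrow> nat) \<Rightarrow> complex"

definition hom_indices :: "nat \<Rightarrow> (nat \<times> ('n::finite \<Rightarrow> nat)) set" where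
  "hom_indices r = {(k, \<alpha>). k + (\<Sum>i\<in>UNIV. \<alpha> i) = r}"

lemma finite_hom_indices [simp]: "finite (hom_indices r :: (nat \<times> ('n::finite \<Rightarrow> nat)) set)"
proof (rule finite_subset)
  show "(hom_indices r :: (nat \<times> ('n \<Rightarrow> nat)) set) \<subseteq> {..r} \<times> (UNIV \<rightarrow>\<^sub>E {..r})"
  proof
    fix x :: "nat \<times> ('n \<Rightarrow> nat)"
    assume "x \<in> hom_indices r"
    then obtain k \<alpha> where x: "x = (k, \<alpha>)" "k + (\<Sum>i\<in>UNIV. \<alpha> i) = r"
      by (auto simp: hom_indices_def)
    have "\<alpha> i \<le> r" for i
      using member_le_sum[of i UNIV \<alpha>] x(2) by simp
    with x show "x \<in> {..r} \<times> (UNIV \<rightarrow>\<^sub>E {..r})"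
      by (auto simp: PiE_UNIV_domain)
  qed
  show "finite ({..r} \<times> (UNIV \<rightarrow>\<^sub>E {..r}) :: (nat \<times> ('n \<Rightarrow> nat)) set)"
    by (intro finite_cartesian_product finite_PiE) auto
qed

text \<open>
  The symbol of the part of order \<^term>\<open>r\<close>, as a polynomial in \<open>\<lambda>\<close>.  The argument \<^term>\<open>\<zeta>\<close> is complex
  because the symbol is needed both at real vectors and at \<open>\<i>\<close> times real vectors.
\<close>

definition hom_symbol :: "('n::finite) coeffs \<Rightarrow> nat \<Rightarrow> complex ^ 'n \<Rightarrow> complex poly" where
  "hom_symbol c r \<zeta> = (\<Sum>(k, \<alpha>)\<in>hom_indices r. monom (c k \<alpha> * (\<Prod>i\<in>UNIV. (\<zeta> $ i) ^ \<alpha> i)) k)"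

definition cvec :: "real ^ 'n \<Rightarrow> complex ^ 'n" where
  "cvec \<xi> = (\<chi> i. complex_of_real (\<xi> $ i))"

definition ivec :: "real ^ 'n \<Rightarrow> complex ^ 'n" where
  "ivec \<xi> = (\<chi> i. \<i> * complex_of_real (\<xi> $ i))"

definition full_symbol :: "('n::finite) coeffs \<Rightarrow> nat \<Rightarrow> nat \<Rightarrow> complex ^ 'n \<Rightarrow> complex poly" where
  "full_symbol c m l \<zeta> = (\<Sum>j=0..l. hom_symbol c (m - j) \<zeta>)"

text \<open>
  Coefficients are complex; the following says that a coefficient is real and positive.
\<close>

definition pos_coeff :: "complex \<Rightarrow> bool" where
  "pos_coeff z \<longleftrightarrow> z \<in> \<real> \<and> 0 < Re z"

text \<open>
  The coefficient of the pure time derivative has the zero multi-index \<^term>\<open>\<lambda>_. 0\<close>;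
  \<^const>\<open>rsquarefree\<close> says that no root is multiple.
\<close>

definition strictly_hyperbolic :: "('n::finite) coeffs \<Rightarrow> nat \<Rightarrow> bool" where
  "strictly_hyperbolic c r \<longleftrightarrow>
     pos_coeff (c r (\<lambda>_. 0)) \<and>
     (\<forall>\<xi>'\<in>sphere 0 1.
        rsquarefree (hom_symbol c r (cvec \<xi>')) \<and>
        (\<forall>z. poly (hom_symbol c r (cvec \<xi>')) z = 0 \<longrightarrow> z \<in> \<real>))"

text \<open>
  The lists \<^term>\<open>xs\<close> and \<^term>\<open>ys\<close> are the ordered roots, repeated according to multiplicity;
  the length conditions say that the degrees are \<open>r - 1\<close> and \<open>r\<close> and that all roots are real.
\<close>

definition strictly_interlace :: "complex poly \<Rightarrow> complex poly \<Rightarrow> bool" where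
  "strictly_interlace p q \<longleftrightarrow>
     p \<noteq> 0 \<and> q \<noteq> 0 \<and> degree q = degree p + 1 \<and>
     (\<exists>xs ys :: real list.
        sorted xs \<and> sorted ys \<and>
        length xs = degree p \<and> length ys = degree q \<and>
        proots p = mset (map complex_of_real xs) \<and>
        proots q = mset (map complex_of_real ys) \<and>
        (\<forall>i<length xs. ys ! i < xs ! i \<and> xs ! i < ys ! (i + 1)))"

end

theory Submission
  imports Defs
begin

text \<open>
  The idea is a change of scale.  Let \<open>r = m - \<ell>\<close>, let \<open>\<xi> = |\<xi>| \<xi>'\<close> and put \<open>s = i|\<xi>|\<close>.  By
  homogeneity,
  \<open>Q(s\<mu>, i\<xi>) = s\<^sup>r (P\<^sub>r(\<mu>, \<xi>') + s P\<^sub>r\<^sub>+\<^sub>1(\<mu>, \<xi>') + s\<^sup>2 (\<dots>))\<close>,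
  so for small \<open>|\<xi>|\<close> the roots \<open>\<lambda> = s\<mu>\<close> are governed by a regular perturbation of \<open>P\<^sub>r(\<cdot>, \<xi>')\<close>.  Its
  roots \<open>\<beta>\<^sub>j\<close> are simple, and first order perturbation theory gives
  \<open>\<mu>\<^sub>j = \<beta>\<^sub>j - s P\<^sub>r\<^sub>+\<^sub>1(\<beta>\<^sub>j)/P\<^sub>r'(\<beta>\<^sub>j) + O(s\<^sup>2)\<close>.  Multiplying by \<open>s\<close>, and using \<open>s\<^sup>2 = -|\<xi>|\<^sup>2\<close> and the fact
  that \<open>P\<^sub>r/(\<lambda> - \<beta>\<^sub>j)\<close> has the value \<open>P\<^sub>r'(\<beta>\<^sub>j)\<close> at \<open>\<beta>\<^sub>j\<close>, one gets the asserted expansion, even with an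
  error \<open>O(|\<xi>|\<^sup>3)\<close>.

  The error has to be uniform in the direction \<open>\<xi>'\<close>.  The numbering of the roots \<open>\<beta>\<^sub>j(\<xi>')\<close> may jump
  from one direction to another, so all estimates are made to depend on three numbers: a bound for the coefficients of the
  symbols on the sphere, the resulting bound for the roots, and a positive lower bound for
  \<open>|P\<^sub>r'|\<close> at the roots, which exists by compactness (\<open>strictly_hyperbolic_pderiv_bound\<close>).  The
  perturbed roots are then found without any limit process (\<open>simple_root_perturbation\<close>): a
  polynomial \<open>P\<close> of degree \<open>d\<close> has a root within \<open>d |P(u)/P'(u)|\<close> of any \<open>u\<close> with \<open>P'(u) \<noteq> 0\<close>.  The same
  three numbers separate different \<open>\<beta>\<^sub>j\<close> (\<open>simple_root_isolated\<close>), so that the \<open>r\<close> roots so obtained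
  are distinct.

  The remaining \<open>\<ell>\<close> roots are treated by dividing off the \<open>r\<close> small ones.  The quotient is monic with
  coefficients that are continuous at \<open>\<xi> = 0\<close>, so its roots can be labelled continuously there
  (\<open>continuous_root_labelling_extend\<close>).  As \<open>Q(\<lambda>, 0)\<close> is \<open>\<lambda>\<^sup>r\<close> times \<open>\<Sum>\<^sub>j c\<^sub>m\<^sub>-\<^sub>j\<^sub>,\<^sub>0 \<lambda>\<^sup>\<ell>\<^sup>-\<^sup>j\<close>, their values at the
  origin are the roots of the second factor.
\<close>

section \<open>Locating roots near a given point\<close>

lemma complex_poly_split_root:
  fixes p :: "complex poly"
  assumes "0 < degree p"
  obtains w q where "p = [:- w, 1:] * q" "degree p = Suc (degree q)"
proof -
  have "\<not> constant (poly p)"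
    using assms by (simp add: constant_degree)
  then obtain w where "poly p w = 0"
    using fundamental_theorem_of_algebra by blast
  then obtain q where q: "p = [:- w, 1:] * q"
    by (auto simp: poly_eq_0_iff_dvd elim: dvdE)
  with assms have "q \<noteq> 0" by auto
  then have "degree p = Suc (degree q)"
    unfolding q by (subst degree_mult_eq) auto
  with q that show thesis by blast
qed

text \<open>
  For \<open>p(z) \<noteq> 0\<close> this is the estimate of the logarithmic derivative
  \<open>p'(z)/p(z) = \<Sum> 1/(z - w)\<close> over the roots, in which every summand is at most \<open>1/D\<close>.
  Splitting off one root at a time proves the form without a division, which is also
  valid when \<open>p\<close> vanishes at \<open>z\<close>.
\<close>

lemma pderiv_bound_of_root_free_disc:
  fixes p :: "complex poly"
  assumes "\<And>w. poly p w = 0 \<Longrightarrow> D \<le> norm (z - w)" and "0 \<le> D"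
  shows "D * norm (poly (pderiv p) z) \<le> degree p * norm (poly p z)"
  using assms(1)
proof (induction "degree p" arbitrary: p)
  case 0
  then show ?case by (metis pderiv_eq_0_iff poly_0 norm_zero mult_zero_right of_nat_0 mult_zero_left order_refl)
next
  case (Suc n)
  from Suc.hyps(2) have "0 < degree p" by simp
  then obtain w q where q: "p = [:- w, 1:] * q" and dq: "degree p = Suc (degree q)"
    by (rule complex_poly_split_root)
  have IH: "D * norm (poly (pderiv q) z) \<le> degree q * norm (poly q z)"
    using Suc.hyps dq Suc.prems by (intro Suc.hyps(1)) (auto simp: q)
  have Dw: "D \<le> norm (z - w)"
    by (rule Suc.prems) (simp add: q)
  have "poly (pderiv p) z = poly q z + (z - w) * poly (pderiv q) z"
    unfolding q pderiv_mult by (simp add: pderiv_pCons algebra_simps)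
  then have "D * norm (poly (pderiv p) z)
      \<le> D * (norm (poly q z) + norm (z - w) * norm (poly (pderiv q) z))"
    using \<open>0 \<le> D\<close> norm_triangle_ineq[of "poly q z" "(z - w) * poly (pderiv q) z"]
    by (intro mult_left_mono) (auto simp: norm_mult)
  also have "\<dots> = D * norm (poly q z) + norm (z - w) * (D * norm (poly (pderiv q) z))"
    by (simp add: algebra_simps)
  also have "\<dots> \<le> norm (z - w) * norm (poly q z) + norm (z - w) * (degree q * norm (poly q z))"
    using Dw IH by (intro add_mono mult_right_mono mult_left_mono) auto
  also have "\<dots> = degree p * norm (poly p z)"
    by (simp add: dq) (simp add: q norm_mult algebra_simps flip: norm_mult)
  finally show ?case .
qed

lemma power_bound_of_root_free_disc:
  fixes p :: "complex poly"
  assumes "\<And>w. poly p w = 0 \<Longrightarrow> D \<le> norm (z - w)" and "0 \<le> D" and "lead_coeff p = 1"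
  shows "D ^ degree p \<le> norm (poly p z)"
  using assms(1,3)
proof (induction "degree p" arbitrary: p)
  case 0
  then obtain a where "p = [:a:]" by (metis degree_eq_zeroE)
  then show ?case using 0 by simp
next
  case (Suc n)
  from Suc.hyps(2) have "0 < degree p" by simp
  then obtain w q where q: "p = [:- w, 1:] * q" and dq: "degree p = Suc (degree q)"
    by (rule complex_poly_split_root)
  have lq: "lead_coeff q = 1"
    using Suc.prems(2) unfolding q lead_coeff_mult by simp
  have IH: "D ^ degree q \<le> norm (poly q z)"
    using Suc.hyps dq Suc.prems lq by (intro Suc.hyps(1)) (auto simp: q)
  have Dw: "D \<le> norm (z - w)"
    by (rule Suc.prems) (simp add: q)
  have "D ^ degree p \<le> norm (z - w) * norm (poly q z)"
    using Dw IH \<open>0 \<le> D\<close> by (simp add: dq mult_mono)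
  also have "\<dots> = norm (poly p z)"
    by (simp add: q norm_mult algebra_simps flip: norm_mult)
  finally show ?case .
qed

lemma nearest_root:
  fixes p :: "complex poly"
  assumes "0 < degree p"
  obtains w where "poly p w = 0" "\<And>v. poly p v = 0 \<Longrightarrow> norm (z - w) \<le> norm (z - v)"
proof -
  let ?Z = "{w. poly p w = 0}"
  have "finite ?Z" using assms by (intro poly_roots_finite) auto
  moreover have "?Z \<noteq> {}"
    using fundamental_theorem_of_algebra[of p] assms by (auto simp: constant_degree)
  ultimately obtain w where "is_arg_min (\<lambda>w. norm (z - w)) (\<lambda>w. w \<in> ?Z) w"
    using ex_is_arg_min_if_finite by blast
  then show thesis
    using that[of w] by (auto simp: is_arg_min_linorder)
qed

text \<open>
  An approximate zero at which the derivative does not vanish is close to a true zero.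
  This replaces the implicit function theorem or an argument by Rouche: a good guess for
  a root, together with a lower bound for the derivative there, already locates a root.
\<close>

lemma root_within_Newton_step:
  fixes p :: "complex poly"
  assumes "poly (pderiv p) z \<noteq> 0"
  obtains w where "poly p w = 0"
    "norm (z - w) * norm (poly (pderiv p) z) \<le> degree p * norm (poly p z)"
proof -
  from assms have "0 < degree p"
    by (metis gr0I pderiv_eq_0_iff poly_0)
  then obtain w where w: "poly p w = 0" "\<And>v. poly p v = 0 \<Longrightarrow> norm (z - w) \<le> norm (z - v)"
    using nearest_root by blast
  show thesis
    by (rule that[OF w(1) pderiv_bound_of_root_free_disc]) (use w in auto)
qed

section \<open>Estimates uniform over polynomials with bounded coefficients\<close>

text \<open>
  The constant depends on the degree, on the bound for the coefficients and on the radius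
  only.  This is what makes the expansion of the roots uniform in the direction \<open>\<xi>'\<close>, on which
  the coefficients of the symbols depend.  The induction is on the degree, along
  \<open>p(z) = a + z q(z)\<close>; the bounds on the derivative are part of it because the remainder for
  \<open>p\<close> contains the derivative of \<open>q\<close>.
\<close>

lemma uniform_Taylor_bounds:
  fixes K R :: real
  assumes "0 \<le> K" "0 \<le> R"
  obtains M where "0 < M"
    "\<And>(p :: complex poly) z. \<lbrakk>degree p \<le> d; \<And>k. norm (coeff p k) \<le> K; norm z \<le> R\<rbrakk> \<Longrightarrow>
       norm (poly p z) \<le> M \<and> norm (poly (pderiv p) z) \<le> M"
    "\<And>(p :: complex poly) z w. \<lbrakk>degree p \<le> d; \<And>k. norm (coeff p k) \<le> K; norm z \<le> R; norm w \<le> R\<rbrakk> \<Longrightarrow>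
       norm (poly p w - poly p z) \<le> M * norm (w - z) \<and>
       norm (poly (pderiv p) w - poly (pderiv p) z) \<le> M * norm (w - z) \<and>
       norm (poly p w - poly p z - poly (pderiv p) z * (w - z)) \<le> M * norm (w - z) ^ 2"
proof -
  let ?B = "\<lambda>d M. \<forall>(p :: complex poly) z w. degree p \<le> d \<longrightarrow> (\<forall>k. norm (coeff p k) \<le> K) \<longrightarrow>
       norm z \<le> R \<longrightarrow> norm w \<le> R \<longrightarrow>
       norm (poly p z) \<le> M \<and> norm (poly (pderiv p) z) \<le> M \<and>
       norm (poly p w - poly p z) \<le> M * norm (w - z) \<and>
       norm (poly (pderiv p) w - poly (pderiv p) z) \<le> M * norm (w - z) \<and>
       norm (poly p w - poly p z - poly (pderiv p) z * (w - z)) \<le> M * norm (w - z) ^ 2"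
  have "\<exists>M>0. ?B d M"
  proof (induction d)
    case 0
    have "?B 0 (K + 1)"
    proof (intro allI impI)
      fix p :: "complex poly" and z w :: complex
      assume p: "degree p \<le> 0" and c: "\<forall>k. norm (coeff p k) \<le> K"
      from p obtain a where [simp]: "p = [:a:]" by (metis degree_eq_zeroE le_zero_eq)
      have "norm a \<le> K" using c[rule_format, of 0] by simp
      then show "norm (poly p z) \<le> K + 1 \<and> norm (poly (pderiv p) z) \<le> K + 1 \<and>
       norm (poly p w - poly p z) \<le> (K + 1) * norm (w - z) \<and>
       norm (poly (pderiv p) w - poly (pderiv p) z) \<le> (K + 1) * norm (w - z) \<and>
       norm (poly p w - poly p z - poly (pderiv p) z * (w - z)) \<le> (K + 1) * norm (w - z) ^ 2"
        using assms by simp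
    qed
    then show ?case using assms by (intro exI[of _ "K + 1"]) auto
  next
    case (Suc d)
    then obtain M where M: "M > 0" and B: "?B d M" by blast
    define N where "N = K + (2 + R) * M"
    have "?B (Suc d) N"
    proof (intro allI impI)
      fix p :: "complex poly" and z w :: complex
      assume p: "degree p \<le> Suc d" and c: "\<forall>k. norm (coeff p k) \<le> K"
        and z: "norm z \<le> R" and w: "norm w \<le> R"
      obtain a q where pq: "p = pCons a q" by (cases p)
      have "degree q \<le> d" using p unfolding pq by (auto split: if_splits)
      moreover have "\<forall>k. norm (coeff q k) \<le> K"
        using c unfolding pq by (metis coeff_pCons_Suc)
      ultimately have q: "norm (poly q z) \<le> M" "norm (poly (pderiv q) z) \<le> M"
         "norm (poly q w - poly q z) \<le> M * norm (w - z)"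
         "norm (poly (pderiv q) w - poly (pderiv q) z) \<le> M * norm (w - z)"
         "norm (poly q w - poly q z - poly (pderiv q) z * (w - z)) \<le> M * norm (w - z) ^ 2"
        using B z w by blast+
      have a: "norm a \<le> K" using c[rule_format, of 0] unfolding pq by simp
      have 1: "norm (poly p z) \<le> K + R * M"
        unfolding pq poly_pCons using a z q assms
        by (intro order_trans[OF norm_triangle_ineq] add_mono) (auto simp: norm_mult intro!: mult_mono)
      have 2: "norm (poly (pderiv p) z) \<le> M + R * M"
        unfolding pq pderiv_pCons poly_add poly_pCons add_0 using z q assms
        by (intro order_trans[OF norm_triangle_ineq] add_mono) (auto simp: norm_mult intro!: mult_mono)
      have "poly p w - poly p z = w * (poly q w - poly q z) + (w - z) * poly q z"
        by (simp add: pq algebra_simps)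
      also have "norm \<dots> \<le> R * (M * norm (w - z)) + norm (w - z) * M"
        using w q assms
        by (intro order_trans[OF norm_triangle_ineq] add_mono) (auto simp: norm_mult intro!: mult_mono)
      finally have 3: "norm (poly p w - poly p z) \<le> (R * M + M) * norm (w - z)"
        by (simp add: algebra_simps)
      have "poly (pderiv p) w - poly (pderiv p) z =
          (poly q w - poly q z) + (w * (poly (pderiv q) w - poly (pderiv q) z)
            + (w - z) * poly (pderiv q) z)"
        by (simp add: pq pderiv_pCons algebra_simps)
      also have "norm \<dots> \<le> M * norm (w - z) + (R * (M * norm (w - z)) + norm (w - z) * M)"
        using w q assms
        by (intro order_trans[OF norm_triangle_ineq] add_mono) (auto simp: norm_mult intro!: mult_mono)
      finally have 4: "norm (poly (pderiv p) w - poly (pderiv p) z) \<le> (R * M + 2 * M) * norm (w - z)"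
        by (simp add: algebra_simps)
      have "poly p w - poly p z - poly (pderiv p) z * (w - z) =
          w * (poly q w - poly q z - poly (pderiv q) z * (w - z)) + (w - z) ^ 2 * poly (pderiv q) z"
        by (simp add: pq pderiv_pCons algebra_simps power2_eq_square)
      also have "norm \<dots> \<le> R * (M * norm (w - z) ^ 2) + norm (w - z) ^ 2 * M"
        using w q assms
        by (intro order_trans[OF norm_triangle_ineq] add_mono)
          (auto simp: norm_mult norm_power intro!: mult_mono)
      finally have 5: "norm (poly p w - poly p z - poly (pderiv p) z * (w - z))
          \<le> (R * M + M) * norm (w - z) ^ 2"
        by (simp add: algebra_simps)
      have N: "K + R * M \<le> N" "M + R * M \<le> N" "R * M + M \<le> N" "R * M + 2 * M \<le> N"
        using M assms by (auto simp: N_def algebra_simps)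
      from N(3,4) have "(R * M + M) * norm (w - z) \<le> N * norm (w - z)"
        "(R * M + 2 * M) * norm (w - z) \<le> N * norm (w - z)"
        "(R * M + M) * norm (w - z) ^ 2 \<le> N * norm (w - z) ^ 2"
        by (intro mult_right_mono; simp)+
      with 1 2 3 4 5 N(1,2)
      show "norm (poly p z) \<le> N \<and> norm (poly (pderiv p) z) \<le> N \<and>
       norm (poly p w - poly p z) \<le> N * norm (w - z) \<and>
       norm (poly (pderiv p) w - poly (pderiv p) z) \<le> N * norm (w - z) \<and>
       norm (poly p w - poly p z - poly (pderiv p) z * (w - z)) \<le> N * norm (w - z) ^ 2"
        by linarith
    qed
    moreover have "N > 0" using M assms by (auto simp: N_def intro!: add_nonneg_pos)
    ultimately show ?case by blast
  qed
  then obtain M where "M > 0" "?B d M" by blast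
  then show thesis using that[of M] by blast
qed

lemma root_norm_bound:
  fixes p :: "complex poly" and K :: real
  assumes z: "poly p z = 0" and K: "\<And>k. norm (coeff p k) \<le> K" and "0 < norm (lead_coeff p)"
  shows "norm z \<le> 1 + degree p * K / norm (lead_coeff p)"
proof (cases "norm z \<le> 1")
  case True
  have "0 \<le> K" using K[of 0] norm_ge_zero order_trans by blast
  then have "0 \<le> degree p * K / norm (lead_coeff p)" by simp
  with True show ?thesis by linarith
next
  case False
  define a where "a = norm (lead_coeff p)"
  have "0 \<le> K" using K[of 0] norm_ge_zero order_trans by blast
  have "degree p \<noteq> 0"
    using z assms(3) by (metis degree_eq_zeroE poly_const_conv lead_coeff_pCons(2) norm_zero less_irrefl)
  then obtain n where n: "degree p = Suc n" by (cases "degree p") auto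
  have "0 = (\<Sum>k<Suc n. coeff p k * z ^ k) + lead_coeff p * z ^ Suc n"
    using z by (simp add: poly_altdef n flip: lessThan_Suc_atMost)
  then have "lead_coeff p * z ^ Suc n = - (\<Sum>k<Suc n. coeff p k * z ^ k)"
    by (simp add: add_eq_0_iff)
  then have "a * norm z ^ Suc n = norm (\<Sum>k<Suc n. coeff p k * z ^ k)"
    unfolding a_def by (metis norm_minus_cancel norm_mult norm_power)
  also have "\<dots> \<le> (\<Sum>k<Suc n. norm (coeff p k * z ^ k))" by (rule norm_sum)
  also have "\<dots> \<le> (\<Sum>k<Suc n. K * norm z ^ n)"
    using K False \<open>0 \<le> K\<close>
    by (intro sum_mono) (auto simp: norm_mult norm_power intro!: mult_mono power_increasing)
  also have "\<dots> = (Suc n * K) * norm z ^ n" by simp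
  finally have "(a * norm z) * norm z ^ n \<le> (Suc n * K) * norm z ^ n"
    by (simp add: mult_ac)
  moreover have "0 < norm z ^ n" using False by (intro zero_less_power) linarith
  ultimately have "a * norm z \<le> Suc n * K" by (rule mult_right_le_imp_le)
  then have "norm z \<le> Suc n * K / a"
    using assms(3) by (simp add: a_def field_simps)
  then show ?thesis by (simp add: n a_def)
qed

text \<open>
  First order perturbation theory of a simple root \<open>b\<close> of \<open>P\<^sub>0\<close>, uniform over bounded families.
  One Newton step for \<open>P\<^sub>0 + s P\<^sub>1 + s\<^sup>2 P\<^sub>2\<close> starting at \<open>b\<close> leads, to first order in \<open>s\<close>, to the
  point \<open>u = b - s P\<^sub>1(b)/P\<^sub>0'(b)\<close>.  There the perturbed polynomial is \<open>O(s\<^sup>2)\<close>, since its terms of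
  order \<open>0\<close> and \<open>1\<close> in \<open>s\<close> cancel, while its derivative still has modulus at least \<open>\<delta>/2\<close>;
  hence a root lies within \<open>O(s\<^sup>2)\<close> of \<open>u\<close>.
\<close>

lemma simple_root_perturbation:
  fixes K R \<delta> :: real
  assumes "0 \<le> K" "0 \<le> R" "0 < \<delta>"
  obtains C \<epsilon> where "0 < C" "0 < \<epsilon>"
    "\<And>(P0 :: complex poly) P1 P2 s b.
       \<lbrakk>degree P0 \<le> d; degree P1 \<le> d; degree P2 \<le> d;
        \<And>k. norm (coeff P0 k) \<le> K; \<And>k. norm (coeff P1 k) \<le> K; \<And>k. norm (coeff P2 k) \<le> K;
        norm b \<le> R; poly P0 b = 0; \<delta> \<le> norm (poly (pderiv P0) b); norm s \<le> \<epsilon>\<rbrakk> \<Longrightarrow>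
       \<exists>\<mu>. poly (P0 + smult s P1 + smult (s\<^sup>2) P2) \<mu> = 0 \<and>
         norm (\<mu> - (b - s * (poly P1 b / poly (pderiv P0) b))) \<le> C * (norm s)\<^sup>2 \<and>
         norm (\<mu> - b) \<le> C * norm s"
proof -
  obtain M1 where M1: "0 < M1"
    "\<And>(p :: complex poly) z. \<lbrakk>degree p \<le> d; \<And>k. norm (coeff p k) \<le> K; norm z \<le> R\<rbrakk> \<Longrightarrow>
       norm (poly p z) \<le> M1 \<and> norm (poly (pderiv p) z) \<le> M1"
    using uniform_Taylor_bounds[OF assms(1,2), of d] by metis
  define T where "T = M1 / \<delta>"
  have T: "0 < T" using M1 assms by (simp add: T_def)
  obtain M where M: "0 < M"
    "\<And>(p :: complex poly) z. \<lbrakk>degree p \<le> d; \<And>k. norm (coeff p k) \<le> K; norm z \<le> R + T\<rbrakk> \<Longrightarrow>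
       norm (poly p z) \<le> M \<and> norm (poly (pderiv p) z) \<le> M"
    "\<And>(p :: complex poly) z w. \<lbrakk>degree p \<le> d; \<And>k. norm (coeff p k) \<le> K; norm z \<le> R + T; norm w \<le> R + T\<rbrakk> \<Longrightarrow>
       norm (poly p w - poly p z) \<le> M * norm (w - z) \<and>
       norm (poly (pderiv p) w - poly (pderiv p) z) \<le> M * norm (w - z) \<and>
       norm (poly p w - poly p z - poly (pderiv p) z * (w - z)) \<le> M * norm (w - z) ^ 2"
    using uniform_Taylor_bounds[OF assms(1), of "R + T" d] assms(2) T
    by (metis add_nonneg_nonneg less_imp_le)
  define \<epsilon> where "\<epsilon> = min 1 (\<delta> / (2 * (M * (T + 2))))"
  define C1 where "C1 = 2 * d * (M * (T\<^sup>2 + T + 1)) / \<delta>"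
  define C where "C = C1 + T"
  have MT: "0 < M * (T + 2)" using M T by simp
  have \<epsilon>: "0 < \<epsilon>" "\<epsilon> \<le> 1" "M * (T + 2) * \<epsilon> \<le> \<delta> / 2"
  proof -
    show "0 < \<epsilon>" "\<epsilon> \<le> 1" using MT assms by (auto simp: \<epsilon>_def)
    have "M * (T + 2) * \<epsilon> \<le> M * (T + 2) * (\<delta> / (2 * (M * (T + 2))))"
      using MT by (intro mult_left_mono) (auto simp: \<epsilon>_def)
    also have "\<dots> = \<delta> / 2" using MT
      by (metis nonzero_mult_div_cancel_left less_irrefl mult.commute times_divide_eq_right divide_divide_eq_left)
    finally show "M * (T + 2) * \<epsilon> \<le> \<delta> / 2" .
  qed
  have C1: "0 \<le> C1" using M T assms by (simp add: C1_def)
  show thesis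
  proof (rule that[of C \<epsilon>])
    show "0 < C" using C1 T by (simp add: C_def)
    show "0 < \<epsilon>" by fact
    fix P0 P1 P2 :: "complex poly" and s b :: complex
    assume deg: "degree P0 \<le> d" "degree P1 \<le> d" "degree P2 \<le> d"
      and cf: "\<And>k. norm (coeff P0 k) \<le> K" "\<And>k. norm (coeff P1 k) \<le> K" "\<And>k. norm (coeff P2 k) \<le> K"
      and b: "norm b \<le> R" "poly P0 b = 0" and \<delta>: "\<delta> \<le> norm (poly (pderiv P0) b)" and s: "norm s \<le> \<epsilon>"
    define t where "t = poly P1 b / poly (pderiv P0) b"
    define u where "u = b - s * t"
    define P where "P = P0 + smult s P1 + smult (s\<^sup>2) P2"
    have t: "norm t \<le> T"
      unfolding t_def T_def norm_divide using M1 deg cf b assms(3) \<delta> by (intro frac_le) auto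
    have s1: "norm s \<le> 1" using s \<epsilon> by simp
    have ub: "norm (u - b) \<le> norm s * T"
      using t by (simp add: u_def norm_mult mult_left_mono)
    also have "\<dots> \<le> 1 * T" using s1 T by (intro mult_right_mono) auto
    finally have ubT: "norm (u - b) \<le> T" by simp
    have uR: "norm u \<le> R + T"
      using norm_triangle_ineq[of b "u - b"] b ubT by simp
    have bR: "norm b \<le> R + T" using b T by simp
    have dP: "degree P \<le> d"
      unfolding P_def using deg by (intro degree_add_le degree_smult_le[THEN order_trans])
    \<comment> \<open>The choice of \<open>u\<close> makes the first order terms cancel.\<close>
    have sdt: "s * poly P1 b = - poly (pderiv P0) b * (u - b)"
      using \<delta> assms(3) by (auto simp: u_def t_def)
    have "poly P u = (poly P0 u - poly P0 b - poly (pderiv P0) b * (u - b))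
        + (s * (poly P1 u - poly P1 b) + s\<^sup>2 * poly P2 u)"
      using sdt b(2) by (simp add: P_def algebra_simps)
    also have "norm \<dots> \<le> M * norm (u - b) ^ 2 + (norm s * (M * norm (u - b)) + norm s ^ 2 * M)"
      using M(2)[OF deg(3) cf(3) uR] M(3)[OF deg(1) cf(1) bR uR] M(3)[OF deg(2) cf(2) bR uR]
      by (intro order_trans[OF norm_triangle_ineq] add_mono)
        (auto simp: norm_mult norm_power intro!: mult_mono)
    also have "\<dots> \<le> M * (norm s * T) ^ 2 + (norm s * (M * (norm s * T)) + norm s ^ 2 * M)"
      using ub M(1) by (intro add_mono mult_left_mono power_mono) auto
    also have "\<dots> = M * (T\<^sup>2 + T + 1) * norm s ^ 2"
      by (simp add: algebra_simps power2_eq_square)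
    finally have Pu: "norm (poly P u) \<le> M * (T\<^sup>2 + T + 1) * norm s ^ 2" .
    have dPu: "\<delta> / 2 \<le> norm (poly (pderiv P) u)"
    proof -
      have "poly (pderiv P) u - poly (pderiv P0) b = (poly (pderiv P0) u - poly (pderiv P0) b)
         + (s * poly (pderiv P1) u + s\<^sup>2 * poly (pderiv P2) u)"
        by (simp add: P_def pderiv_add pderiv_smult)
      also have "norm \<dots> \<le> M * norm (u - b) + (norm s * M + norm s ^ 2 * M)"
        using M(2)[OF deg(3) cf(3) uR] M(2)[OF deg(2) cf(2) uR] M(3)[OF deg(1) cf(1) bR uR]
        by (intro order_trans[OF norm_triangle_ineq] add_mono)
          (auto simp: norm_mult norm_power intro!: mult_mono)
      also have "\<dots> \<le> M * (norm s * T) + (norm s * M + norm s * M)"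
        using ub M(1) s1
        by (intro add_mono mult_left_mono mult_right_mono) (auto simp: power2_eq_square mult_left_le)
      also have "\<dots> = M * (T + 2) * norm s" by (simp add: algebra_simps)
      also have "\<dots> \<le> M * (T + 2) * \<epsilon>" using s MT by (intro mult_left_mono) auto
      also have "\<dots> \<le> \<delta> / 2" by (rule \<epsilon>)
      finally have "norm (poly (pderiv P) u - poly (pderiv P0) b) \<le> \<delta> / 2" .
      moreover have "norm (poly (pderiv P0) b) \<le> norm (poly (pderiv P) u)
          + norm (poly (pderiv P) u - poly (pderiv P0) b)"
        by (metis norm_minus_commute norm_triangle_sub)
      ultimately show ?thesis using \<delta> by linarith
    qed
    then have "poly (pderiv P) u \<noteq> 0" using assms(3) by auto
    then obtain \<mu> where \<mu>: "poly P \<mu> = 0"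
      "norm (u - \<mu>) * norm (poly (pderiv P) u) \<le> degree P * norm (poly P u)"
      by (rule root_within_Newton_step)
    have "norm (u - \<mu>) * (\<delta> / 2) \<le> norm (u - \<mu>) * norm (poly (pderiv P) u)"
      using dPu by (intro mult_left_mono) auto
    also have "\<dots> \<le> degree P * norm (poly P u)" by (rule \<mu>)
    also have "\<dots> \<le> d * (M * (T\<^sup>2 + T + 1) * norm s ^ 2)"
      using dP Pu by (intro mult_mono) auto
    finally have A: "norm (u - \<mu>) \<le> C1 * norm s ^ 2"
      using assms(3) by (simp add: C1_def field_simps)
    have "norm (\<mu> - u) \<le> C * norm s ^ 2"
      unfolding norm_minus_commute[of \<mu>]
      by (rule order_trans[OF A]) (use T in \<open>auto simp: C_def intro!: mult_right_mono\<close>)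
    moreover have "norm (\<mu> - b) \<le> C * norm s"
    proof -
      have "norm (\<mu> - b) \<le> norm (u - \<mu>) + norm (u - b)"
        by (metis norm_minus_commute norm_triangle_sub norm_triangle_ineq add_diff_eq diff_add_cancel add.commute diff_add_eq)
      also have "\<dots> \<le> C1 * norm s ^ 2 + norm s * T" using A ub by linarith
      also have "\<dots> \<le> C1 * norm s + norm s * T"
        using C1 s1 by (intro add_mono mult_left_mono) (auto simp: power2_eq_square mult_left_le)
      finally show ?thesis by (simp add: C_def algebra_simps)
    qed
    ultimately show "\<exists>\<mu>. poly (P0 + smult s P1 + smult (s\<^sup>2) P2) \<mu> = 0 \<and>
         norm (\<mu> - (b - s * (poly P1 b / poly (pderiv P0) b))) \<le> C * (norm s)\<^sup>2 \<and>
         norm (\<mu> - b) \<le> C * norm s"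
      using \<mu>(1) by (auto simp: P_def u_def t_def)
  qed
qed

text \<open>
  If \<open>b'\<close> is another root, Taylor's formula at \<open>b\<close> gives \<open>|p'(b)| |b' - b| \<le> M |b' - b|\<^sup>2\<close>.
  The separation \<open>\<delta>/M\<close> is uniform, so that roots continued from different simple roots
  stay different for small perturbations of a size independent of the polynomial.
\<close>

lemma simple_root_isolated:
  fixes K R \<delta> :: real
  assumes "0 \<le> K" "0 \<le> R" "0 < \<delta>"
  obtains \<sigma> where "0 < \<sigma>"
    "\<And>(p :: complex poly) b b'. \<lbrakk>degree p \<le> d; \<And>k. norm (coeff p k) \<le> K; norm b \<le> R; norm b' \<le> R;
       poly p b = 0; poly p b' = 0; \<delta> \<le> norm (poly (pderiv p) b); b \<noteq> b'\<rbrakk> \<Longrightarrow> \<sigma> \<le> norm (b' - b)"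
proof -
  obtain M where M: "0 < M"
    "\<And>(p :: complex poly) z w. \<lbrakk>degree p \<le> d; \<And>k. norm (coeff p k) \<le> K; norm z \<le> R; norm w \<le> R\<rbrakk> \<Longrightarrow>
       norm (poly p w - poly p z - poly (pderiv p) z * (w - z)) \<le> M * norm (w - z) ^ 2"
    using uniform_Taylor_bounds[OF assms(1,2), of d] by metis
  show thesis
  proof (rule that[of "\<delta> / M"])
    show "0 < \<delta> / M" using M assms by simp
    fix p :: "complex poly" and b b' :: complex
    assume p: "degree p \<le> d" "\<And>k. norm (coeff p k) \<le> K" "norm b \<le> R" "norm b' \<le> R"
      and z: "poly p b = 0" "poly p b' = 0" and \<delta>: "\<delta> \<le> norm (poly (pderiv p) b)" and ne: "b \<noteq> b'"
    have "\<delta> * norm (b' - b) \<le> norm (poly (pderiv p) b) * norm (b' - b)"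
      using \<delta> by (intro mult_right_mono) auto
    also have "\<dots> \<le> (M * norm (b' - b)) * norm (b' - b)"
      using M(2)[OF p] z by (simp add: norm_mult power2_eq_square mult.assoc)
    finally have "\<delta> \<le> M * norm (b' - b)"
      using ne by (simp add: mult_le_cancel_right)
    then show "\<delta> / M \<le> norm (b' - b)" using M by (simp add: field_simps)
  qed
qed

section \<open>Continuous labellings of roots\<close>

text \<open>
  Synthetic division computes the coefficients of the quotient from the top downwards by
  additions and multiplications with \<open>r\<close>, so they depend continuously on the coefficients of
  \<open>p\<close> and on \<open>r\<close>.
\<close>

lemma isCont_coeff_linear_quotient:
  fixes p q :: "'a::t2_space \<Rightarrow> complex poly"
  assumes pq: "\<And>x. p x = [:- r x, 1:] * q x" and "\<And>x. degree (q x) \<le> d"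
    and "isCont r x0" and "\<And>k. isCont (\<lambda>x. coeff (p x) k) x0"
  shows "isCont (\<lambda>x. coeff (q x) k) x0"
proof -
  have eq: "coeff (q x) k = coeff (p x) (Suc k) + r x * coeff (q x) (Suc k)" for x k
    by (simp add: pq)
  have "d < k + n \<Longrightarrow> isCont (\<lambda>x. coeff (q x) k) x0" for n k
  proof (induction n arbitrary: k)
    case 0
    have "coeff (q x) k = 0" for x
      using assms(2)[of x] 0 by (intro coeff_eq_0) simp
    then show ?case by simp
  next
    case (Suc n)
    then have "isCont (\<lambda>x. coeff (q x) (Suc k)) x0" by simp
    then show ?case
      unfolding eq[of _ k] by (intro continuous_intros assms)
  qed
  from this[of k "Suc d"] show ?thesis by simp
qed

lemma divide_off_continuous_roots:
  fixes p :: "'a::t2_space \<Rightarrow> complex poly" and r :: "'i \<Rightarrow> 'a \<Rightarrow> complex"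
  assumes "finite A"
    and monic: "\<And>x. lead_coeff (p x) = 1" and deg: "\<And>x. degree (p x) = d"
    and cont: "\<And>k. isCont (\<lambda>x. coeff (p x) k) x0"
    and "\<And>i. i \<in> A \<Longrightarrow> isCont (r i) x0"
    and "\<And>x. {# r i x. i \<in># mset_set A #} \<subseteq># proots (p x)"
  obtains q where "\<And>x. proots (p x) = {# r i x. i \<in># mset_set A #} + proots (q x)"
    "\<And>x. lead_coeff (q x) = 1" "\<And>x. degree (q x) = d - card A"
    "\<And>k. isCont (\<lambda>x. coeff (q x) k) x0"
proof -
  have "\<exists>q. (\<forall>x. proots (p x) = {# r i x. i \<in># mset_set A #} + proots (q x) \<and>
      lead_coeff (q x) = 1 \<and> degree (q x) = d - card A) \<and> (\<forall>k. isCont (\<lambda>x. coeff (q x) k) x0)"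
    using assms(1,5,6)
  proof (induction A)
    case empty
    then show ?case using monic deg cont by (intro exI[of _ p]) auto
  next
    case (insert a A)
    have ins: "{# r i x. i \<in># mset_set (insert a A) #} = {# r i x. i \<in># mset_set A #} + {# r a x #}" for x
      using insert.hyps by simp
    have "{# r i x. i \<in># mset_set A #} \<subseteq># proots (p x)" for x
      by (rule subset_mset.order_trans[OF _ insert.prems(2)[of x]]) (simp add: ins)
    then obtain q where q: "\<And>x. proots (p x) = {# r i x. i \<in># mset_set A #} + proots (q x)"
      "\<And>x. lead_coeff (q x) = 1" "\<And>x. degree (q x) = d - card A"
      "\<And>k. isCont (\<lambda>x. coeff (q x) k) x0"
      using insert.IH insert.prems(1) by blast
    have q0: "q x \<noteq> 0" for x using q(2)[of x] by auto
    have "r a x \<in># proots (q x)" for x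
      using insert.prems(2)[of x] unfolding q(1)[of x] ins subset_mset.add_le_cancel_left by simp
    then have "[:- r a x, 1:] dvd q x" for x
      using q0 by (simp add: poly_eq_0_iff_dvd)
    then obtain q' where q': "\<And>x. q x = [:- r a x, 1:] * q' x"
      unfolding dvd_def by metis
    have q'0: "q' x \<noteq> 0" for x using q0[of x] unfolding q'[of x] by auto
    have d: "degree (q x) = Suc (degree (q' x))" for x
      using q'0 by (simp add: q' degree_mult_eq del: mult_pCons_left)
    have "proots (q x) = {# r a x #} + proots (q' x)" for x
      unfolding q' using q'0[of x] by (subst proots_mult) auto
    then have "proots (p x) = {# r i x. i \<in># mset_set (insert a A) #} + proots (q' x)" for x
      using q(1)[of x] insert.hyps by simp
    moreover have "lead_coeff (q' x) = 1" for x
      using q(2)[of x] unfolding q' lead_coeff_mult by simp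
    moreover have "degree (q' x) = d - card (insert a A)" for x
      using d[of x] q(3)[of x] insert.hyps by simp
    moreover have "isCont (\<lambda>x. coeff (q' x) k) x0" for k
    proof (rule isCont_coeff_linear_quotient)
      show "q x = [:- r a x, 1:] * q' x" for x by (rule q')
      show "degree (q' x) \<le> d" for x using d[of x] q(3)[of x] by linarith
      show "isCont (r a) x0" using insert.prems(1) by simp
    qed (rule q(4))
    ultimately show ?case by blast
  qed
  then show thesis using that by blast
qed

text \<open>
  Fix a root \<open>a\<close> at \<open>x\<^sub>0\<close> and let \<open>r x\<close> be a root of \<open>p x\<close> nearest to \<open>a\<close>.  As the
  modulus of a monic polynomial is the product of the distances to its roots,
  \<open>|a - r x|\<^sup>d \<le> |p x (a)|\<close>, and the right-hand side tends to \<open>|p x\<^sub>0 (a)| = 0\<close>.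
\<close>

lemma continuous_root_exists:
  fixes p :: "'a::t2_space \<Rightarrow> complex poly"
  assumes monic: "\<And>x. lead_coeff (p x) = 1" and deg: "\<And>x. degree (p x) = d" "0 < d"
    and cont: "\<And>k. isCont (\<lambda>x. coeff (p x) k) x0"
  obtains r where "\<And>x. poly (p x) (r x) = 0" "isCont r x0"
proof -
  obtain a where a: "poly (p x0) a = 0"
    using fundamental_theorem_of_algebra[of "p x0"] deg by (auto simp: constant_degree)
  have "\<exists>w. poly (p x) w = 0 \<and> (\<forall>v. poly (p x) v = 0 \<longrightarrow> norm (a - w) \<le> norm (a - v))" for x
    using nearest_root[of "p x" a] deg by (metis (no_types))
  then obtain r where r: "\<And>x. poly (p x) (r x) = 0"
      "\<And>x v. poly (p x) v = 0 \<Longrightarrow> norm (a - r x) \<le> norm (a - v)"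
    by metis
  have rx0: "r x0 = a" using r(2)[OF a] by simp
  have "poly (p x) a = (\<Sum>k\<le>d. coeff (p x) k * a ^ k)" for x
    by (simp add: poly_altdef deg)
  then have "isCont (\<lambda>x. poly (p x) a) x0"
    using cont by (auto intro!: continuous_intros)
  then have lim: "((\<lambda>x. root d (norm (poly (p x) a))) \<longlongrightarrow> root d (norm (poly (p x0) a))) (at x0)"
    unfolding isCont_def by (intro tendsto_intros)
  have "norm (a - r x) \<le> root d (norm (poly (p x) a))" for x
  proof -
    have "norm (a - r x) ^ d \<le> norm (poly (p x) a)"
      using power_bound_of_root_free_disc[of "p x" "norm (a - r x)" a] r monic deg(1) by auto
    then have "root d (norm (a - r x) ^ d) \<le> root d (norm (poly (p x) a))"
      using deg by simp
    then show ?thesis using deg by (simp add: real_root_power_cancel)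
  qed
  then have "((\<lambda>x. r x - a) \<longlongrightarrow> 0) (at x0)"
    using lim a deg by (intro Lim_null_comparison[OF _ lim[simplified a norm_zero real_root_zero]])
      (auto simp: norm_minus_commute)
  then have "isCont r x0"
    unfolding isCont_def rx0 by (simp add: LIM_zero_iff)
  with r(1) that show thesis by blast
qed

text \<open>
  The roots of a polynomial depend continuously on its coefficients, in a form in which
  some of the labels may be prescribed.  After the prescribed roots have been divided off,
  the quotient still has continuous coefficients and supplies one more continuous root;
  this is repeated until all roots are labelled.  Continuity is asserted at the single
  point \<open>x\<^sub>0\<close>; a labelling that is continuous everywhere need not exist.
\<close>

lemma continuous_root_labelling_extend:
  fixes p :: "'a::t2_space \<Rightarrow> complex poly" and r :: "nat \<Rightarrow> 'a \<Rightarrow> complex"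
  assumes monic: "\<And>x. lead_coeff (p x) = 1" and deg: "\<And>x. degree (p x) = d"
    and cont: "\<And>k. isCont (\<lambda>x. coeff (p x) k) x0"
    and "n \<le> d"
    and "\<And>i. i \<in> {1..n} \<Longrightarrow> isCont (r i) x0"
    and "\<And>x. {# r i x. i \<in># mset_set {1..n} #} \<subseteq># proots (p x)"
  obtains r' where "\<And>i. i \<in> {1..n} \<Longrightarrow> r' i = r i"
    "\<And>i. i \<in> {1..d} \<Longrightarrow> isCont (r' i) x0"
    "\<And>x. proots (p x) = {# r' i x. i \<in># mset_set {1..d} #}"
proof -
  have "\<exists>r'. (\<forall>i\<in>{1..n}. r' i = r i) \<and> (\<forall>i\<in>{1..d}. isCont (r' i) x0) \<and>
      (\<forall>x. proots (p x) = {# r' i x. i \<in># mset_set {1..d} #})"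
    using assms(4-)
  proof (induction "d - n" arbitrary: n r)
    case 0
    then have "n = d" by simp
    moreover have "proots (p x) = {# r i x. i \<in># mset_set {1..d} #}" for x
    proof -
      have "{# r i x. i \<in># mset_set {1..d} #} \<subseteq># proots (p x)"
        using 0 \<open>n = d\<close> by blast
      moreover have "size {# r i x. i \<in># mset_set {1..d} #} = size (proots (p x))"
        by (simp add: size_proots_complex deg)
      ultimately show ?thesis
        by (metis mset_subset_size less_irrefl subset_mset.le_imp_less_or_eq)
    qed
    ultimately show ?case using 0 by auto
  next
    case (Suc N)
    obtain q where q: "\<And>x. proots (p x) = {# r i x. i \<in># mset_set {1..n} #} + proots (q x)"
      "\<And>x. lead_coeff (q x) = 1" "\<And>x. degree (q x) = d - n"
      "\<And>k. isCont (\<lambda>x. coeff (q x) k) x0"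
      using divide_off_continuous_roots[of "{1..n}" p d x0 r] monic deg cont Suc.prems by auto
    obtain w where w: "\<And>x. poly (q x) (w x) = 0" "isCont w x0"
      using continuous_root_exists[of q "d - n" x0, OF q(2,3) _ q(4)] Suc.hyps(2) by force
    define r1 where "r1 = r(Suc n := w)"
    have "q x \<noteq> 0" for x using q(2)[of x] by auto
    then have wq: "{# w x #} \<subseteq># proots (q x)" for x using w by simp
    have eq: "{# r1 i x. i \<in># mset_set {1..Suc n} #} = {# r i x. i \<in># mset_set {1..n} #} + {# w x #}" for x
    proof -
      have "{# r1 i x. i \<in># mset_set {1..n} #} = {# r i x. i \<in># mset_set {1..n} #}"
        by (intro image_mset_cong) (auto simp: r1_def)
      then show ?thesis by (simp add: atLeastAtMostSuc_conv r1_def)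
    qed
    have "\<exists>r'. (\<forall>i\<in>{1..Suc n}. r' i = r1 i) \<and> (\<forall>i\<in>{1..d}. isCont (r' i) x0) \<and>
      (\<forall>x. proots (p x) = {# r' i x. i \<in># mset_set {1..d} #})"
    proof (rule Suc.hyps(1))
      show "N = d - Suc n" "Suc n \<le> d" using Suc.hyps(2) by auto
      show "isCont (r1 i) x0" if "i \<in> {1..Suc n}" for i
        using that Suc.prems(2)[of i] w(2) by (cases "i = Suc n") (auto simp: r1_def)
      show "{# r1 i x. i \<in># mset_set {1..Suc n} #} \<subseteq># proots (p x)" for x
        unfolding eq q(1)[of x] using wq by simp
    qed
    moreover have "r1 i = r i" if "i \<in> {1..n}" for i
      using that by (auto simp: r1_def)
    ultimately show ?case by (metis atLeastAtMostSuc_conv atLeastAtMost_iff le_SucI)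
  qed
  then show thesis using that by blast
qed

section \<open>Homogeneous symbols\<close>

lemma poly_hom_symbol:
  "poly (hom_symbol c q \<zeta>) z =
     (\<Sum>(k, \<alpha>)\<in>hom_indices q. c k \<alpha> * (\<Prod>i\<in>UNIV. (\<zeta> $ i) ^ \<alpha> i) * z ^ k)"
  by (simp add: hom_symbol_def poly_sum poly_monom case_prod_unfold)

lemma coeff_hom_symbol:
  "coeff (hom_symbol c q \<zeta>) n =
     (\<Sum>(k, \<alpha>)\<in>hom_indices q. if k = n then c k \<alpha> * (\<Prod>i\<in>UNIV. (\<zeta> $ i) ^ \<alpha> i) else 0)"
  by (simp add: hom_symbol_def coeff_sum case_prod_unfold)

lemma degree_hom_symbol_le: "degree (hom_symbol c q \<zeta>) \<le> q"
  unfolding hom_symbol_def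
  by (intro degree_sum_le[OF finite_hom_indices]) (auto simp: hom_indices_def intro!: order_trans[OF degree_monom_le])

lemma hom_indices_cases:
  assumes "x \<in> hom_indices q"
  obtains "x = (q, \<lambda>_. 0)" | k \<alpha> i where "x = (k, \<alpha>)" "k < q" "0 < \<alpha> i" "k + (\<Sum>i\<in>UNIV. \<alpha> i) = q"
proof -
  obtain k \<alpha> where x: "x = (k, \<alpha>)" "k + (\<Sum>i\<in>UNIV. \<alpha> i) = q"
    using assms by (auto simp: hom_indices_def)
  show thesis
  proof (cases "\<alpha> = (\<lambda>_. 0)")
    case True
    with x that(1) show thesis by simp
  next
    case False
    then obtain i where i: "0 < \<alpha> i" by (auto simp: fun_eq_iff)
    then have "0 < (\<Sum>i\<in>UNIV. \<alpha> i)" by (intro sum_pos2[of _ i]) auto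
    with x i that(2) show thesis by simp
  qed
qed

lemma coeff_hom_symbol_top: "coeff (hom_symbol c q (\<zeta> :: complex ^ 'n :: finite)) q = c q (\<lambda>_. 0)"
proof -
  have "coeff (hom_symbol c q \<zeta>) q =
      (\<Sum>x\<in>(hom_indices q :: (nat \<times> ('n \<Rightarrow> nat)) set). if x = (q, \<lambda>_. 0) then c q (\<lambda>_. 0) else 0)"
    unfolding coeff_hom_symbol
    by (intro sum.cong refl, elim hom_indices_cases) auto
  also have "\<dots> = c q (\<lambda>_. 0)"
    by (simp add: sum.delta) (simp add: hom_indices_def)
  finally show ?thesis .
qed

lemma degree_hom_symbol:
  fixes \<zeta> :: "complex ^ 'n :: finite"
  assumes "c q (\<lambda>_. 0) \<noteq> 0"
  shows "degree (hom_symbol c q \<zeta>) = q"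
  using assms degree_hom_symbol_le[of c q \<zeta>] coeff_hom_symbol_top[of c q \<zeta>]
  by (simp add: le_antisym le_degree)

lemma hom_symbol_0: "hom_symbol c q (0 :: complex ^ 'n :: finite) = monom (c q (\<lambda>_. 0)) q"
proof -
  have "(\<Prod>i\<in>UNIV. (0 :: complex) ^ \<alpha> i) = 0" if "0 < \<alpha> i" for \<alpha> :: "'n \<Rightarrow> nat" and i
    using that by (intro prod_zero) (auto intro!: exI[of _ i])
  then have "hom_symbol c q (0 :: complex ^ 'n) =
      (\<Sum>x\<in>(hom_indices q :: (nat \<times> ('n \<Rightarrow> nat)) set). if x = (q, \<lambda>_. 0) then monom (c q (\<lambda>_. 0)) q else 0)"
    unfolding hom_symbol_def
    by (intro sum.cong refl, elim hom_indices_cases) auto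
  also have "\<dots> = monom (c q (\<lambda>_. 0)) q"
    by (simp add: sum.delta) (simp add: hom_indices_def)
  finally show ?thesis .
qed

lemma poly_hom_symbol_scale:
  fixes c :: "('n::finite) coeffs"
  shows "poly (hom_symbol c q (\<chi> i. s * \<zeta> $ i)) (s * z) = s ^ q * poly (hom_symbol c q \<zeta>) z"
  unfolding poly_hom_symbol sum_distrib_left
proof (rule sum.cong[OF refl], clarify)
  fix k and \<alpha> :: "'n \<Rightarrow> nat" assume "(k, \<alpha>) \<in> hom_indices q"
  then have q: "q = k + (\<Sum>i\<in>UNIV. \<alpha> i)" by (simp add: hom_indices_def)
  have "s ^ q = s ^ k * (\<Prod>i\<in>UNIV. s ^ \<alpha> i)"
    unfolding q by (simp only: power_add power_sum)
  then show "c k \<alpha> * (\<Prod>i\<in>UNIV. ((\<chi> i. s * \<zeta> $ i) $ i) ^ \<alpha> i) * (s * z) ^ k =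
      s ^ q * (c k \<alpha> * (\<Prod>i\<in>UNIV. (\<zeta> $ i) ^ \<alpha> i) * z ^ k)"
    by (simp add: power_mult_distrib prod.distrib mult_ac)
qed

lemma norm_coeff_hom_symbol_le:
  assumes "norm \<xi> \<le> 1"
  shows "norm (coeff (hom_symbol c q (cvec \<xi>)) n) \<le> (\<Sum>(k, \<alpha>)\<in>hom_indices q. norm (c k \<alpha>))"
proof -
  have "norm (cvec \<xi> $ i) \<le> 1" for i
    using component_le_norm_cart[of \<xi> i] assms by (simp add: cvec_def)
  then have "norm (\<Prod>i\<in>UNIV. (cvec \<xi> $ i) ^ \<alpha> i) \<le> 1" for \<alpha>
    unfolding prod_norm[symmetric] norm_power
    by (intro prod_le_1) (auto intro: power_le_one)
  then have "norm (if k = n then c k \<alpha> * (\<Prod>i\<in>UNIV. (cvec \<xi> $ i) ^ \<alpha> i) else 0) \<le> norm (c k \<alpha>)" for k \<alpha>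
    by (simp add: norm_mult mult_left_le)
  then show ?thesis
    unfolding coeff_hom_symbol by (intro sum_norm_le) auto
qed

lemma continuous_on_coeff_hom_symbol [continuous_intros]:
  assumes "continuous_on S f"
  shows "continuous_on S (\<lambda>x. coeff (hom_symbol c q (f x)) n)"
proof -
  have "continuous_on S (\<lambda>x. if fst y = n then c (fst y) (snd y) * (\<Prod>i\<in>UNIV. (f x $ i) ^ snd y i) else 0)" for y
    by (cases "fst y = n") (auto intro!: continuous_intros assms)
  then show ?thesis
    unfolding coeff_hom_symbol case_prod_unfold by (intro continuous_on_sum) auto
qed

lemma continuous_on_cvec [continuous_intros]:
  "continuous_on S f \<Longrightarrow> continuous_on S (\<lambda>x. cvec (f x))"
  unfolding cvec_def by (intro continuous_intros)

lemma continuous_on_ivec [continuous_intros]: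
  "continuous_on S f \<Longrightarrow> continuous_on S (\<lambda>x. ivec (f x))"
  unfolding ivec_def by (intro continuous_intros)

lemma poly_eq_sum_coeff:
  fixes p :: "'a :: comm_semiring_1 poly"
  assumes "degree p \<le> d"
  shows "poly p z = (\<Sum>k\<le>d. coeff p k * z ^ k)"
  by (subst poly_as_sum_of_monoms'[OF assms, symmetric]) (simp add: poly_sum poly_monom)

lemma strictly_hyperbolic_nonzero:
  assumes "strictly_hyperbolic c r"
  shows "c r (\<lambda>_. 0) \<noteq> 0"
  using assms by (auto simp: strictly_hyperbolic_def pos_coeff_def)

text \<open>
  The pairs of a unit vector and a root of modulus at most \<open>R\<close> form a compact set, on which
  the derivative has no zero because all roots are simple.
\<close>

lemma strictly_hyperbolic_pderiv_bound:
  fixes c :: "('n::finite) coeffs"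
  assumes "strictly_hyperbolic c r"
  obtains \<delta> where "0 < \<delta>"
    "\<And>\<xi> z. \<lbrakk>\<xi> \<in> sphere 0 1; norm z \<le> R; poly (hom_symbol c r (cvec \<xi>)) z = 0\<rbrakk> \<Longrightarrow>
       \<delta> \<le> norm (poly (pderiv (hom_symbol c r (cvec \<xi>))) z)"
proof -
  define D :: "(real ^ 'n) \<times> complex \<Rightarrow> real"
    where "D = (\<lambda>(\<xi>, z). norm (poly (pderiv (hom_symbol c r (cvec \<xi>))) z))"
  define Z where "Z = (sphere (0 :: real ^ 'n) 1 \<times> cball (0 :: complex) R) \<inter>
      {x. poly (hom_symbol c r (cvec (fst x))) (snd x) = 0}"
  have 1: "poly (hom_symbol c r \<zeta>) z = (\<Sum>k\<le>r. coeff (hom_symbol c r \<zeta>) k * z ^ k)" for \<zeta> z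
    by (rule poly_eq_sum_coeff[OF degree_hom_symbol_le])
  have 2: "poly (pderiv (hom_symbol c r \<zeta>)) z =
      (\<Sum>k\<le>r. of_nat (Suc k) * coeff (hom_symbol c r \<zeta>) (Suc k) * z ^ k)" for \<zeta> z
    by (subst poly_eq_sum_coeff[of _ r])
      (auto simp: degree_pderiv coeff_pderiv intro!: order_trans[OF _ degree_hom_symbol_le[of c r \<zeta>]])
  have "closed {x :: (real ^ 'n) \<times> complex. poly (hom_symbol c r (cvec (fst x))) (snd x) = 0}"
    unfolding 1 by (intro closed_Collect_eq continuous_intros)
  then have Z: "compact Z"
    unfolding Z_def by (intro compact_Int_closed compact_Times) auto
  have contD: "continuous_on Z D"
    unfolding D_def case_prod_unfold 2 by (intro continuous_intros)
  have pos: "0 < D x" if "x \<in> Z" for x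
    using that assms
    by (auto simp: Z_def D_def strictly_hyperbolic_def rsquarefree_roots)
  show thesis
  proof (cases "Z = {}")
    case True
    show thesis
    proof (rule that[of 1])
      fix \<xi> :: "real ^ 'n" and z assume "\<xi> \<in> sphere 0 1" "norm z \<le> R" "poly (hom_symbol c r (cvec \<xi>)) z = 0"
      then have "(\<xi>, z) \<in> Z" by (simp add: Z_def)
      with True show "1 \<le> norm (poly (pderiv (hom_symbol c r (cvec \<xi>))) z)" by simp
    qed simp
  next
    case False
    then obtain x where x: "x \<in> Z" "\<And>y. y \<in> Z \<Longrightarrow> D x \<le> D y"
      using continuous_attains_inf[OF Z _ contD] by blast
    show thesis
    proof (rule that[of "D x"])
      fix \<xi> :: "real ^ 'n" and z assume "\<xi> \<in> sphere 0 1" "norm z \<le> R" "poly (hom_symbol c r (cvec \<xi>)) z = 0"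
      then have "(\<xi>, z) \<in> Z" by (simp add: Z_def)
      then show "D x \<le> norm (poly (pderiv (hom_symbol c r (cvec \<xi>))) z)"
        using x(2) by (fastforce simp: D_def)
    qed (use pos x in auto)
  qed
qed

lemma degree_coeff_full_symbol:
  fixes \<zeta> :: "complex ^ 'n :: finite"
  assumes "l < m"
  shows "degree (full_symbol c m l \<zeta>) \<le> m" "coeff (full_symbol c m l \<zeta>) m = c m (\<lambda>_. 0)"
proof -
  show "degree (full_symbol c m l \<zeta>) \<le> m"
    unfolding full_symbol_def
    by (intro degree_sum_le order_trans[OF degree_hom_symbol_le]) auto
  have "coeff (hom_symbol c (m - j) \<zeta>) m = (if j = 0 then c m (\<lambda>_. 0) else 0)" for j
    using assms degree_hom_symbol_le[of c "m - j" \<zeta>] coeff_hom_symbol_top[of c m \<zeta>]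
    by (auto intro!: coeff_eq_0)
  then show "coeff (full_symbol c m l \<zeta>) m = c m (\<lambda>_. 0)"
    by (simp add: full_symbol_def coeff_sum sum.delta)
qed

lemma full_symbol_0:
  assumes "l \<le> m"
  shows "full_symbol c m l (0 :: complex ^ 'n :: finite) =
    monom 1 (m - l) * (\<Sum>j=0..l. monom (c (m - j) (\<lambda>_. 0)) (l - j))"
  unfolding full_symbol_def hom_symbol_0 sum_distrib_left mult_monom
  using assms by (intro sum.cong) auto

text \<open>
  With \<open>\<lambda> = i|\<xi>|\<mu>\<close> both arguments of the symbol carry the same factor \<open>i|\<xi>|\<close>, which homogeneity
  (\<open>poly_hom_symbol_scale\<close>) can then extract.
\<close>

lemma ivec_polar:
  "ivec \<xi> = (\<chi> i. (\<i> * of_real (norm \<xi>)) * cvec (\<xi> /\<^sub>R norm \<xi>) $ i)"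
  by (cases "\<xi> = 0") (auto simp: ivec_def cvec_def vec_eq_iff)

text \<open>
  Every homogeneous part of order \<open>q\<close> contributes the power \<open>s\<^sup>q\<close>.  After the lowest power is
  factored out, the full symbol becomes a regular perturbation of its part of lowest order.
\<close>

lemma poly_full_symbol_rescaled:
  fixes \<xi> :: "real ^ 'n :: finite" and r l :: nat
  assumes "1 \<le> l"
  defines "s \<equiv> \<i> * of_real (norm \<xi>)" and "\<zeta> \<equiv> cvec (\<xi> /\<^sub>R norm \<xi>)"
  shows "poly (full_symbol c (r + l) l (ivec \<xi>)) (s * \<mu>) =
    s ^ r * poly (hom_symbol c r \<zeta> + smult s (hom_symbol c (r + 1) \<zeta>)
      + smult (s\<^sup>2) (\<Sum>k=2..l. smult (s ^ (k - 2)) (hom_symbol c (r + k) \<zeta>))) \<mu>"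
proof -
  have "poly (full_symbol c (r + l) l (ivec \<xi>)) (s * \<mu>) =
      (\<Sum>j=0..l. s ^ (r + l - j) * poly (hom_symbol c (r + l - j) \<zeta>) \<mu>)"
    unfolding full_symbol_def ivec_polar[of \<xi>] s_def \<zeta>_def
    by (simp only: poly_sum poly_hom_symbol_scale)
  also have "\<dots> = (\<Sum>k=0..l. s ^ (r + k) * poly (hom_symbol c (r + k) \<zeta>) \<mu>)"
    by (rule sum.reindex_bij_witness[of _ "\<lambda>k. l - k" "\<lambda>j. l - j"]) auto
  also have "{0..l} = insert 0 (insert 1 {2..l})" using assms(1) by auto
  also have "(\<Sum>k\<in>\<dots>. s ^ (r + k) * poly (hom_symbol c (r + k) \<zeta>) \<mu>) =
      s ^ r * (poly (hom_symbol c r \<zeta>) \<mu> + s * poly (hom_symbol c (r + 1) \<zeta>) \<mu>)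
      + (\<Sum>k=2..l. s ^ (r + k) * poly (hom_symbol c (r + k) \<zeta>) \<mu>)"
    by (simp add: algebra_simps)
  also have "(\<Sum>k=2..l. s ^ (r + k) * poly (hom_symbol c (r + k) \<zeta>) \<mu>) =
      s ^ r * (s\<^sup>2 * (\<Sum>k=2..l. s ^ (k - 2) * poly (hom_symbol c (r + k) \<zeta>) \<mu>))"
    unfolding sum_distrib_left
  proof (rule sum.cong[OF refl])
    fix k assume "k \<in> {2..l}"
    then have "r + k = r + (2 + (k - 2))" by auto
    then have "s ^ (r + k) = s ^ r * (s\<^sup>2 * s ^ (k - 2))"
      by (metis power_add)
    then show "s ^ (r + k) * poly (hom_symbol c (r + k) \<zeta>) \<mu> =
        s ^ r * (s\<^sup>2 * (s ^ (k - 2) * poly (hom_symbol c (r + k) \<zeta>) \<mu>))"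
      by (simp add: mult_ac)
  qed
  finally show ?thesis by (simp add: poly_sum algebra_simps)
qed

section \<open>The low-frequency roots\<close>

lemma rsquarefree_proots_inj:
  assumes "rsquarefree p" and "proots p = {# f j. j \<in># mset_set A #}" and "finite A"
  shows "inj_on f A"
proof (rule inj_onI, rule ccontr)
  fix i j assume ij: "i \<in> A" "j \<in> A" "f i = f j" "i \<noteq> j"
  have p0: "p \<noteq> 0" using assms(1) by (simp add: rsquarefree_def)
  have "{# f i, f i #} = {# f k. k \<in># mset_set {i, j} #}"
    using ij by simp
  also have "\<dots> \<subseteq># proots p"
    unfolding assms(2) using ij assms(3)
    by (intro image_mset_subseteq_mono subset_imp_msubset_mset_set) auto
  finally have "2 \<le> count (proots p) (f i)"
    by (auto dest: mset_subset_eq_count[of _ _ "f i"])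
  moreover have "order (f i) p \<le> 1"
    using rsquarefree_root_order[OF assms(1) _ p0, of "f i"] order_0I[of p "f i"]
    by (cases "poly p (f i) = 0") simp_all
  ultimately show False using p0 by simp
qed

lemma poly_div_linear_eq_pderiv:
  fixes p :: "'a :: field poly"
  assumes "poly p b = 0"
  shows "poly (p div [:- b, 1:]) b = poly (pderiv p) b"
proof -
  obtain q where q: "p = [:- b, 1:] * q"
    using assms by (auto simp: poly_eq_0_iff_dvd elim: dvdE)
  then have "p div [:- b, 1:] = q"
    by (metis nonzero_mult_div_cancel_left pCons_eq_0_iff one_neq_zero)
  moreover have "poly (pderiv p) b = poly q b"
    unfolding q pderiv_mult by (simp add: pderiv_pCons)
  ultimately show ?thesis by simp
qed

text \<open>
  The \<open>r\<close> roots of the full symbol that tend to zero, with error bounds uniform in the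
  direction.  Strict hyperbolicity makes the roots \<open>\<beta>\<^sub>j\<close> simple, compactness of the sphere makes
  this quantitative, and \<open>simple_root_perturbation\<close> applies to the rescaled symbol with
  \<open>s = i|\<xi>|\<close>; multiplication by \<open>s\<close> turns an error \<open>O(|\<xi>|\<^sup>2)\<close> in \<open>\<mu>\<close> into \<open>O(|\<xi>|\<^sup>3)\<close> in \<open>\<lambda>\<close>.
  Injectivity of \<open>f\<close> ensures that the \<open>r\<close> roots found account for \<open>r\<close> roots of the full symbol
  counted with multiplicity.
\<close>

lemma low_frequency_roots:
  fixes c :: "('n::finite) coeffs" and r l :: nat and \<beta> :: "nat \<Rightarrow> real ^ 'n \<Rightarrow> real"
  assumes l: "1 \<le> l" and hyp: "strictly_hyperbolic c r"
    and roots: "\<And>\<xi>'. \<xi>' \<in> sphere 0 1 \<Longrightarrow>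
      proots (hom_symbol c r (cvec \<xi>')) = {# complex_of_real (\<beta> j \<xi>'). j \<in># mset_set {1..r} #}"
  obtains C \<epsilon> where "0 < C" "0 < \<epsilon>"
    "\<And>\<xi>. \<lbrakk>0 < norm \<xi>; norm \<xi> < \<epsilon>\<rbrakk> \<Longrightarrow> \<exists>f. inj_on f {1..r} \<and> (\<forall>j\<in>{1..r}.
       poly (full_symbol c (r + l) l (ivec \<xi>)) (f j) = 0 \<and> norm (f j) \<le> C * norm \<xi> \<and>
       (let \<zeta> = cvec (\<xi> /\<^sub>R norm \<xi>); b = complex_of_real (\<beta> j (\<xi> /\<^sub>R norm \<xi>)) in
         norm (f j - (\<i> * of_real (norm \<xi>) * b + of_real (norm \<xi>) ^ 2 *
           (poly (hom_symbol c (r + 1) \<zeta>) b / poly (pderiv (hom_symbol c r \<zeta>)) b))) \<le> C * norm \<xi> ^ 3))"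
proof -
  have c0: "c r (\<lambda>_. 0) \<noteq> 0" using hyp by (rule strictly_hyperbolic_nonzero)
  define K0 where "K0 = (\<Sum>q\<le>r + l. \<Sum>(k, \<alpha>)\<in>hom_indices q. norm (c k \<alpha>))"
  \<comment> \<open>The factor \<open>l + 1\<close> lets \<open>K\<close> bound the coefficients of the remainder \<open>P2\<close> as well.\<close>
  define K where "K = real (l + 1) * K0"
  have K0: "0 \<le> K0" unfolding K0_def by (intro sum_nonneg) auto
  have KK: "K0 \<le> K" "0 \<le> K" using K0 by (auto simp: K_def algebra_simps)
  have coeff_le: "norm (coeff (hom_symbol c q (cvec \<xi>)) n) \<le> K0"
    if "q \<le> r + l" "norm \<xi> = 1" for q n and \<xi> :: "real ^ 'n"
  proof -
    have "norm (coeff (hom_symbol c q (cvec \<xi>)) n) \<le> (\<Sum>(k, \<alpha>)\<in>hom_indices q. norm (c k \<alpha>))"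
      using that by (intro norm_coeff_hom_symbol_le) simp
    also have "\<dots> \<le> K0"
      unfolding K0_def using that
      by (intro member_le_sum[of q "{..r + l}" "\<lambda>q. \<Sum>(k, \<alpha>)\<in>hom_indices q. norm (c k \<alpha>)"])
        (auto intro!: sum_nonneg)
    finally show ?thesis .
  qed
  \<comment> \<open>By \<open>root_norm_bound\<close> all \<open>\<beta>\<^sub>j(\<xi>')\<close> lie in the disc of radius \<open>R\<close>.\<close>
  define R where "R = 1 + r * K / norm (c r (\<lambda>_. 0))"
  have R: "0 \<le> R" using KK by (simp add: R_def)
  obtain \<delta> where \<delta>: "0 < \<delta>"
    "\<And>\<xi> z. \<lbrakk>\<xi> \<in> sphere 0 1; norm z \<le> R; poly (hom_symbol c r (cvec \<xi>)) z = 0\<rbrakk> \<Longrightarrow>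
       \<delta> \<le> norm (poly (pderiv (hom_symbol c r (cvec \<xi>))) z)"
    using strictly_hyperbolic_pderiv_bound[OF hyp] by metis
  obtain C0 \<epsilon>0 where C0: "0 < C0" "0 < \<epsilon>0"
    "\<And>(P0 :: complex poly) P1 P2 s b.
       \<lbrakk>degree P0 \<le> r + l; degree P1 \<le> r + l; degree P2 \<le> r + l;
        \<And>k. norm (coeff P0 k) \<le> K; \<And>k. norm (coeff P1 k) \<le> K; \<And>k. norm (coeff P2 k) \<le> K;
        norm b \<le> R; poly P0 b = 0; \<delta> \<le> norm (poly (pderiv P0) b); norm s \<le> \<epsilon>0\<rbrakk> \<Longrightarrow>
       \<exists>\<mu>. poly (P0 + smult s P1 + smult (s\<^sup>2) P2) \<mu> = 0 \<and>
         norm (\<mu> - (b - s * (poly P1 b / poly (pderiv P0) b))) \<le> C0 * (norm s)\<^sup>2 \<and>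
         norm (\<mu> - b) \<le> C0 * norm s"
    by (rule simple_root_perturbation[OF KK(2) R \<delta>(1), of "r + l"]) blast
  obtain \<sigma> where \<sigma>: "0 < \<sigma>"
    "\<And>(p :: complex poly) b b'. \<lbrakk>degree p \<le> r + l; \<And>k. norm (coeff p k) \<le> K; norm b \<le> R; norm b' \<le> R;
       poly p b = 0; poly p b' = 0; \<delta> \<le> norm (poly (pderiv p) b); b \<noteq> b'\<rbrakk> \<Longrightarrow> \<sigma> \<le> norm (b' - b)"
    by (rule simple_root_isolated[OF KK(2) R \<delta>(1), of "r + l"]) blast
  \<comment> \<open>The last term forces perturbed roots to stay within half the separation \<open>\<sigma>\<close> of their origin.\<close>
  define \<epsilon> where "\<epsilon> = min (min 1 \<epsilon>0) (\<sigma> / (2 * C0))"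
  have \<epsilon>: "0 < \<epsilon>" "\<epsilon> \<le> 1" "\<epsilon> \<le> \<epsilon>0" "2 * C0 * \<epsilon> \<le> \<sigma>"
  proof -
    show "0 < \<epsilon>" "\<epsilon> \<le> 1" "\<epsilon> \<le> \<epsilon>0" using C0(1,2) \<sigma>(1) by (auto simp: \<epsilon>_def)
    have "\<epsilon> \<le> \<sigma> / (2 * C0)" by (simp add: \<epsilon>_def)
    then show "2 * C0 * \<epsilon> \<le> \<sigma>" using C0(1) by (simp add: field_simps)
  qed
  show thesis
  proof (rule that[of "C0 + R" \<epsilon>])
    show "0 < C0 + R" using C0 R by simp
    show "0 < \<epsilon>" by fact
    fix \<xi> :: "real ^ 'n"
    assume \<xi>: "0 < norm \<xi>" "norm \<xi> < \<epsilon>"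
    define \<rho> where "\<rho> = norm \<xi>"
    define s where "s = \<i> * complex_of_real \<rho>"
    define \<xi>' where "\<xi>' = \<xi> /\<^sub>R norm \<xi>"
    define P where "P q = hom_symbol c q (cvec \<xi>')" for q
    define P2 where "P2 = (\<Sum>k=2..l. smult (s ^ (k - 2)) (P (r + k)))"
    define b where "b j = complex_of_real (\<beta> j \<xi>')" for j
    have \<rho>: "0 < \<rho>" "\<rho> < \<epsilon>" "\<rho> \<le> 1" "norm s = \<rho>"
      using \<xi> \<epsilon> by (auto simp: \<rho>_def s_def norm_mult)
    have n\<xi>': "norm \<xi>' = 1" "\<xi>' \<in> sphere 0 1" using \<xi> by (auto simp: \<xi>'_def)
    have Pdeg: "degree (P q) \<le> r + l" if "q \<le> r + l" for q
      using degree_hom_symbol_le[of c q "cvec \<xi>'"] that by (simp add: P_def)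
    have Pc: "norm (coeff (P q) k) \<le> K0" if "q \<le> r + l" for q k
      unfolding P_def using that n\<xi>'(1) by (rule coeff_le)
    have PcK: "norm (coeff (P q) k) \<le> K" if "q \<le> r + l" for q k
      using Pc[OF that] KK order_trans by blast
    have P2deg: "degree P2 \<le> r + l"
      unfolding P2_def by (intro degree_sum_le order_trans[OF degree_smult_le] Pdeg) auto
    have P2c: "norm (coeff P2 k) \<le> K" for k
    proof -
      have "norm (coeff P2 k) \<le> (\<Sum>i=2..l. K0)"
        unfolding P2_def coeff_sum
      proof (intro sum_norm_le)
        fix i assume "i \<in> {2..l}"
        then have "norm (s ^ (i - 2)) * norm (coeff (P (r + i)) k) \<le> 1 * K0"
          using \<rho> Pc by (intro mult_mono) (auto simp: norm_power intro: power_le_one)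
        then show "norm (coeff (smult (s ^ (i - 2)) (P (r + i))) k) \<le> K0"
          by (simp add: norm_mult)
      qed
      also have "\<dots> \<le> K" using K0 by (simp add: K_def mult_right_mono)
      finally show ?thesis .
    qed
    have sqf: "rsquarefree (P r)"
      using hyp n\<xi>' by (auto simp: strictly_hyperbolic_def P_def)
    then have P0: "P r \<noteq> 0" by (simp add: rsquarefree_def)
    have proots: "proots (P r) = {# b j. j \<in># mset_set {1..r} #}"
      unfolding P_def b_def by (rule roots) (rule n\<xi>')
    have b_inj: "inj_on b {1..r}"
      by (rule rsquarefree_proots_inj[OF sqf proots]) simp
    have b_root: "poly (P r) (b j) = 0" if "j \<in> {1..r}" for j
    proof -
      have "b j \<in># proots (P r)" unfolding proots using that by auto
      then show ?thesis using P0 by simp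
    qed
    have degP: "degree (P r) = r" unfolding P_def using c0 by (rule degree_hom_symbol)
    have lcP: "lead_coeff (P r) = c r (\<lambda>_. 0)"
      unfolding degP by (simp add: P_def coeff_hom_symbol_top)
    have b_le: "norm (b j) \<le> R" if "j \<in> {1..r}" for j
      using root_norm_bound[OF b_root[OF that] PcK] c0 lcP degP by (simp add: R_def)
    have b_pd: "\<delta> \<le> norm (poly (pderiv (P r)) (b j))" if "j \<in> {1..r}" for j
      using \<delta>(2)[OF n\<xi>'(2) b_le[OF that]] b_root[OF that] by (simp add: P_def)
    have "\<exists>\<mu>. poly (P r + smult s (P (r + 1)) + smult (s\<^sup>2) P2) \<mu> = 0 \<and>
         norm (\<mu> - (b j - s * (poly (P (r + 1)) (b j) / poly (pderiv (P r)) (b j)))) \<le> C0 * (norm s)\<^sup>2 \<and>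
         norm (\<mu> - b j) \<le> C0 * norm s" if "j \<in> {1..r}" for j
      by (rule C0(3)) (use l \<rho> \<epsilon> that in \<open>auto intro: Pdeg PcK P2deg P2c b_le b_root b_pd\<close>)
    then obtain \<mu> where \<mu>: "\<And>j. j \<in> {1..r} \<Longrightarrow> poly (P r + smult s (P (r + 1)) + smult (s\<^sup>2) P2) (\<mu> j) = 0"
       "\<And>j. j \<in> {1..r} \<Longrightarrow> norm (\<mu> j - (b j - s * (poly (P (r + 1)) (b j) / poly (pderiv (P r)) (b j)))) \<le> C0 * \<rho>\<^sup>2"
       "\<And>j. j \<in> {1..r} \<Longrightarrow> norm (\<mu> j - b j) \<le> C0 * \<rho>"
      unfolding \<rho>(4) by metis
    define f where "f j = s * \<mu> j" for j
    have "inj_on f {1..r}"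
    proof (rule inj_onI, rule ccontr)
      fix i j assume ij: "i \<in> {1..r}" "j \<in> {1..r}" "f i = f j" "i \<noteq> j"
      have "\<mu> i = \<mu> j" using ij \<rho> by (auto simp: f_def s_def)
      then have "norm (b j - b i) \<le> C0 * \<rho> + C0 * \<rho>"
        using norm_triangle_ineq4[of "\<mu> i - b i" "\<mu> j - b j"] \<mu>(3)[OF ij(1)] \<mu>(3)[OF ij(2)] by simp
      also have "\<dots> < 2 * C0 * \<epsilon>" using \<rho> C0 by simp
      also have "\<dots> \<le> \<sigma>" by (rule \<epsilon>)
      also have "\<sigma> \<le> norm (b j - b i)"
        using ij inj_onD[OF b_inj, of i j]
        by (intro \<sigma>(2)[of "P r"] Pdeg PcK b_le b_root b_pd) auto
      finally show False by simp
    qed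
    moreover have "poly (full_symbol c (r + l) l (ivec \<xi>)) (f j) = 0" if "j \<in> {1..r}" for j
      using poly_full_symbol_rescaled[OF l, of c r \<xi> "\<mu> j"] \<mu>(1)[OF that]
      by (simp add: f_def s_def \<rho>_def P2_def P_def \<xi>'_def)
    moreover have "norm (f j) \<le> (C0 + R) * \<rho>" if "j \<in> {1..r}" for j
    proof -
      have "norm (\<mu> j) \<le> C0 * \<rho> + R"
        using norm_triangle_ineq[of "\<mu> j - b j" "b j"] \<mu>(3)[OF that] b_le[OF that] by simp
      also have "\<dots> \<le> C0 + R" using \<rho> C0 by (simp add: mult_left_le)
      finally have "\<rho> * norm (\<mu> j) \<le> \<rho> * (C0 + R)" using \<rho> by (intro mult_left_mono) auto
      then show ?thesis by (simp add: f_def norm_mult \<rho> mult.commute)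
    qed
    moreover have "norm (f j - (\<i> * of_real \<rho> * b j + of_real \<rho> ^ 2 *
        (poly (P (r + 1)) (b j) / poly (pderiv (P r)) (b j)))) \<le> (C0 + R) * \<rho> ^ 3" if "j \<in> {1..r}" for j
    proof -
      define t where "t = poly (P (r + 1)) (b j) / poly (pderiv (P r)) (b j)"
      have ss: "s * s = - (of_real \<rho> ^ 2)"
        by (simp add: s_def complex_eq_iff power2_eq_square)
      have "f j - (\<i> * of_real \<rho> * b j + of_real \<rho> ^ 2 * t) = s * \<mu> j - (s * b j - (s * s) * t)"
        unfolding ss by (simp add: f_def s_def)
      also have "\<dots> = s * (\<mu> j - (b j - s * t))"
        by (simp add: algebra_simps)
      also have "norm \<dots> \<le> \<rho> * (C0 * \<rho>\<^sup>2)"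
        unfolding norm_mult \<rho>(4) t_def using \<mu>(2)[OF that] \<rho> by (intro mult_left_mono) auto
      also have "\<dots> = C0 * \<rho> ^ 3" by (simp add: power2_eq_square power3_eq_cube)
      also have "\<dots> \<le> (C0 + R) * \<rho> ^ 3" using \<rho> R by (intro mult_right_mono) auto
      finally show ?thesis unfolding t_def .
    qed
    ultimately show "\<exists>f. inj_on f {1..r} \<and> (\<forall>j\<in>{1..r}.
       poly (full_symbol c (r + l) l (ivec \<xi>)) (f j) = 0 \<and> norm (f j) \<le> (C0 + R) * norm \<xi> \<and>
       (let \<zeta> = cvec (\<xi> /\<^sub>R norm \<xi>); b = complex_of_real (\<beta> j (\<xi> /\<^sub>R norm \<xi>)) in
         norm (f j - (\<i> * of_real (norm \<xi>) * b + of_real (norm \<xi>) ^ 2 *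
           (poly (hom_symbol c (r + 1) \<zeta>) b / poly (pderiv (hom_symbol c r \<zeta>)) b))) \<le> (C0 + R) * norm \<xi> ^ 3))"
      unfolding Let_def \<rho>_def b_def P_def \<xi>'_def by blast
  qed
qed

theorem lemma2p1:
  fixes c :: "('n::finite) coeffs"
    and m l :: nat
    and \<beta> :: "nat \<Rightarrow> real ^ 'n \<Rightarrow> real"
  assumes "1 \<le> l" and "l \<le> m - 1"
    and "c m (\<lambda>_. 0) = 1"
    and "pos_coeff (c (m - l) (\<lambda>_. 0))"
    and "strictly_hyperbolic c (m - l)"
    and "strictly_hyperbolic c (m - l + 1)"
    and "\<And>\<xi>'. \<xi>' \<in> sphere 0 1 \<Longrightarrow>
           strictly_interlace (hom_symbol c (m - l) (cvec \<xi>')) (hom_symbol c (m - l + 1) (cvec \<xi>'))"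
    and "\<And>\<xi>'. \<xi>' \<in> sphere 0 1 \<Longrightarrow>
           proots (hom_symbol c (m - l) (cvec \<xi>')) =
             {# complex_of_real (\<beta> j \<xi>'). j \<in># mset_set {1..m - l} #}"
  shows "\<exists>lam :: nat \<Rightarrow> real ^ 'n \<Rightarrow> complex.
           (\<forall>\<xi>. proots (full_symbol c m l (ivec \<xi>)) = {# lam j \<xi>. j \<in># mset_set {1..m} #}) \<and>
           (\<forall>j\<in>{1..m}. isCont (lam j) 0) \<and>
           {# lam j 0. j \<in># mset_set {m - l + 1..m} #} =
             proots (\<Sum>j=0..l. monom (c (m - j) (\<lambda>_. 0)) (l - j)) \<and>
           (\<forall>j\<in>{1..m - l}.
              (\<lambda>\<xi>. let \<xi>' = \<xi> /\<^sub>R norm \<xi>; b = complex_of_real (\<beta> j \<xi>') in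
                 lam j \<xi> - (\<i> * of_real (norm \<xi>) * b
                   + of_real (norm \<xi>) ^ 2
                     * (poly (hom_symbol c (m - l + 1) (cvec \<xi>')) b
                        / poly (hom_symbol c (m - l) (cvec \<xi>') div [:- b, 1:]) b)))
              \<in> o[at 0](\<lambda>\<xi>. complex_of_real (norm \<xi>) ^ 2))"
proof -
  define r where "r = m - l"
  have lm: "l < m" using assms(1,2) by linarith
  then have m: "m = r + l" by (simp add: r_def)
  define Q where "Q \<xi> = full_symbol c m l (ivec \<xi>)" for \<xi> :: "real ^ 'n"
  have Qdeg: "degree (Q \<xi>) = m" for \<xi>
    using degree_coeff_full_symbol[OF lm, of c "ivec \<xi>"] assms(3)
    by (metis Q_def le_antisym le_degree one_neq_zero)
  have Qlead: "lead_coeff (Q \<xi>) = 1" for \<xi>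
    unfolding Qdeg using degree_coeff_full_symbol[OF lm, of c "ivec \<xi>"] assms(3) by (simp add: Q_def)
  have Q0: "Q \<xi> \<noteq> 0" for \<xi> using Qlead[of \<xi>] by auto
  have Qcont: "isCont (\<lambda>\<xi>. coeff (Q \<xi>) k) x" for k x
  proof -
    have "continuous_on UNIV (\<lambda>\<xi> :: real ^ 'n. coeff (Q \<xi>) k)"
      unfolding Q_def full_symbol_def coeff_sum by (intro continuous_intros)
    then show ?thesis by (simp add: continuous_on_eq_continuous_at)
  qed
  define G where "G = (\<Sum>j=0..l. monom (c (m - j) (\<lambda>_. 0)) (l - j))"
  have "Q 0 = monom 1 r * G"
    using full_symbol_0[of l m c] lm by (simp add: Q_def G_def r_def ivec_def zero_vec_def)
  then have Q_at_0: "proots (Q 0) = replicate_mset r 0 + proots G"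
    using Q0[of 0] by (simp add: proots_mult monom_altdef proots_power)
  obtain C \<epsilon> where C: "0 < C" "0 < \<epsilon>"
    "\<And>\<xi>. \<lbrakk>0 < norm \<xi>; norm \<xi> < \<epsilon>\<rbrakk> \<Longrightarrow> \<exists>f. inj_on f {1..r} \<and> (\<forall>j\<in>{1..r}.
       poly (Q \<xi>) (f j) = 0 \<and> norm (f j) \<le> C * norm \<xi> \<and>
       (let \<zeta> = cvec (\<xi> /\<^sub>R norm \<xi>); b = complex_of_real (\<beta> j (\<xi> /\<^sub>R norm \<xi>)) in
         norm (f j - (\<i> * of_real (norm \<xi>) * b + of_real (norm \<xi>) ^ 2 *
           (poly (hom_symbol c (r + 1) \<zeta>) b / poly (pderiv (hom_symbol c r \<zeta>)) b))) \<le> C * norm \<xi> ^ 3))"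
    using low_frequency_roots[OF assms(1,5,8)] unfolding Q_def by (metis m r_def)
  have "\<exists>f. {# f j. j \<in># mset_set {1..r} #} \<subseteq># proots (Q \<xi>) \<and> (\<xi> = 0 \<longrightarrow> (\<forall>j. f j = 0)) \<and>
      (0 < norm \<xi> \<longrightarrow> norm \<xi> < \<epsilon> \<longrightarrow> (\<forall>j\<in>{1..r}. norm (f j) \<le> C * norm \<xi> \<and>
       (let \<zeta> = cvec (\<xi> /\<^sub>R norm \<xi>); b = complex_of_real (\<beta> j (\<xi> /\<^sub>R norm \<xi>)) in
         norm (f j - (\<i> * of_real (norm \<xi>) * b + of_real (norm \<xi>) ^ 2 *
           (poly (hom_symbol c (r + 1) \<zeta>) b / poly (pderiv (hom_symbol c r \<zeta>)) b))) \<le> C * norm \<xi> ^ 3)))"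
    for \<xi>
  proof -
    consider "\<xi> = 0" | "0 < norm \<xi>" "norm \<xi> < \<epsilon>" | "\<xi> \<noteq> 0" "\<epsilon> \<le> norm \<xi>"
      by fastforce
    then show ?thesis
    proof cases
      \<comment> \<open>The value \<open>0\<close> at \<open>\<xi> = 0\<close> is the one that makes the prescribed roots continuous there.\<close>
      case 1
      then show ?thesis
        by (intro exI[of _ "\<lambda>_. 0"]) (simp add: Q_at_0 image_mset_const_eq)
    next
      case 2
      then obtain f where f: "inj_on f {1..r}" "\<forall>j\<in>{1..r}.
       poly (Q \<xi>) (f j) = 0 \<and> norm (f j) \<le> C * norm \<xi> \<and>
       (let \<zeta> = cvec (\<xi> /\<^sub>R norm \<xi>); b = complex_of_real (\<beta> j (\<xi> /\<^sub>R norm \<xi>)) in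
         norm (f j - (\<i> * of_real (norm \<xi>) * b + of_real (norm \<xi>) ^ 2 *
           (poly (hom_symbol c (r + 1) \<zeta>) b / poly (pderiv (hom_symbol c r \<zeta>)) b))) \<le> C * norm \<xi> ^ 3)"
        using C(3) by blast
      have "mset_set (f ` {1..r}) \<subseteq># proots (Q \<xi>)"
        using f(2) Q0[of \<xi>] by (auto simp: subseteq_mset_def count_mset_set' order_root Suc_le_eq)
      then have "{# f j. j \<in># mset_set {1..r} #} \<subseteq># proots (Q \<xi>)"
        by (simp only: image_mset_mset_set[OF f(1)])
      with f(2) 2 show ?thesis by (intro exI[of _ f]) auto
    next
      \<comment> \<open>Away from the origin any enumeration of the roots will do; the labelling lemma provides one.\<close>
      case 3
      obtain f where "proots (Q \<xi>) = {# f j \<xi>. j \<in># mset_set {1..m} #}"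
        by (rule continuous_root_labelling_extend[of Q m \<xi> 0 "\<lambda>_ _. 0", OF Qlead Qdeg Qcont]) auto
      then have "{# f j \<xi>. j \<in># mset_set {1..r} #} \<subseteq># proots (Q \<xi>)"
        by (simp add: m image_mset_subseteq_mono)
      with 3 show ?thesis by (intro exI[of _ "\<lambda>j. f j \<xi>"]) auto
    qed
  qed
  then obtain F where F: "\<And>\<xi>. {# F \<xi> j. j \<in># mset_set {1..r} #} \<subseteq># proots (Q \<xi>)" "\<And>j. F 0 j = 0"
    "\<And>\<xi> j. \<lbrakk>0 < norm \<xi>; norm \<xi> < \<epsilon>; j \<in> {1..r}\<rbrakk> \<Longrightarrow> norm (F \<xi> j) \<le> C * norm \<xi> \<and>
       (let \<zeta> = cvec (\<xi> /\<^sub>R norm \<xi>); b = complex_of_real (\<beta> j (\<xi> /\<^sub>R norm \<xi>)) in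
         norm (F \<xi> j - (\<i> * of_real (norm \<xi>) * b + of_real (norm \<xi>) ^ 2 *
           (poly (hom_symbol c (r + 1) \<zeta>) b / poly (pderiv (hom_symbol c r \<zeta>)) b))) \<le> C * norm \<xi> ^ 3)"
    by metis
  have near_0: "\<forall>\<^sub>F \<xi> in at (0 :: real ^ 'n). 0 < norm \<xi> \<and> norm \<xi> < e" if "0 < e" for e
    using that by (auto simp: eventually_at intro!: exI[of _ e])
  have Fcont: "isCont (\<lambda>\<xi>. F \<xi> j) 0" if "j \<in> {1..r}" for j
  proof -
    have "((\<lambda>\<xi>. F \<xi> j) \<longlongrightarrow> 0) (at 0)"
    proof (rule Lim_null_comparison)
      show "\<forall>\<^sub>F \<xi> in at 0. norm (F \<xi> j) \<le> C * norm \<xi>"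
        using near_0[OF C(2)] by eventually_elim (use F(3) that in blast)
      show "((\<lambda>\<xi> :: real ^ 'n. C * norm \<xi>) \<longlongrightarrow> 0) (at 0)"
        by (auto intro!: tendsto_eq_intros)
    qed
    then show ?thesis by (simp add: isCont_def F(2))
  qed
  \<comment> \<open>Only the roots that do not tend to zero remain to be labelled.\<close>
  obtain lam where lam: "\<And>j. j \<in> {1..r} \<Longrightarrow> lam j = (\<lambda>\<xi>. F \<xi> j)"
    "\<And>j. j \<in> {1..m} \<Longrightarrow> isCont (lam j) 0"
    "\<And>\<xi>. proots (Q \<xi>) = {# lam j \<xi>. j \<in># mset_set {1..m} #}"
    by (rule continuous_root_labelling_extend[of Q m 0 r "\<lambda>j \<xi>. F \<xi> j", OF Qlead Qdeg Qcont])
      (use Fcont F(1) m in auto)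
  have "{# lam j 0. j \<in># mset_set {r + 1..m} #} = proots G"
  proof -
    have "{1..m} = {1..r} \<union> {r + 1..m}" by (auto simp: m)
    then have "mset_set {1..m} = mset_set {1..r} + mset_set {r + 1..m}"
      by (simp add: mset_set_Union)
    moreover have "{# lam j 0. j \<in># mset_set {1..r} #} = {# 0. j \<in># mset_set {1..r} #}"
      by (intro image_mset_cong) (simp add: lam(1) F(2))
    ultimately have "proots (Q 0) = replicate_mset r 0 + {# lam j 0. j \<in># mset_set {r + 1..m} #}"
      using lam(3)[of 0] by (simp add: image_mset_const_eq)
    then show ?thesis using Q_at_0 by simp
  qed
  moreover have "(\<lambda>\<xi>. let \<xi>' = \<xi> /\<^sub>R norm \<xi>; b = complex_of_real (\<beta> j \<xi>') in
                 lam j \<xi> - (\<i> * of_real (norm \<xi>) * b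
                   + of_real (norm \<xi>) ^ 2
                     * (poly (hom_symbol c (r + 1) (cvec \<xi>')) b
                        / poly (hom_symbol c r (cvec \<xi>') div [:- b, 1:]) b)))
              \<in> o[at 0](\<lambda>\<xi>. complex_of_real (norm \<xi>) ^ 2)" if j: "j \<in> {1..r}" for j
  proof (rule landau_o.smallI)
    fix e :: real assume "0 < e"
    then have "0 < min \<epsilon> (e / C)" using C(1,2) by simp
    from near_0[OF this]
    show "\<forall>\<^sub>F \<xi> in at 0. norm (let \<xi>' = \<xi> /\<^sub>R norm \<xi>; b = complex_of_real (\<beta> j \<xi>') in
                 lam j \<xi> - (\<i> * of_real (norm \<xi>) * b
                   + of_real (norm \<xi>) ^ 2
                     * (poly (hom_symbol c (r + 1) (cvec \<xi>')) b
                        / poly (hom_symbol c r (cvec \<xi>') div [:- b, 1:]) b)))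
           \<le> e * norm (complex_of_real (norm \<xi>) ^ 2)"
    proof eventually_elim
      fix \<xi> :: "real ^ 'n"
      assume \<xi>: "0 < norm \<xi> \<and> norm \<xi> < min \<epsilon> (e / C)"
      define \<xi>' where "\<xi>' = \<xi> /\<^sub>R norm \<xi>"
      define b where "b = complex_of_real (\<beta> j \<xi>')"
      have "\<xi>' \<in> sphere 0 1" using \<xi> by (simp add: \<xi>'_def)
      then have "b \<in># proots (hom_symbol c r (cvec \<xi>'))"
        using assms(8)[of \<xi>'] j unfolding r_def b_def by auto
      then have "poly (hom_symbol c r (cvec \<xi>')) b = 0"
        by (cases "hom_symbol c r (cvec \<xi>') = 0") auto
      note check = poly_div_linear_eq_pderiv[OF this]
      have "norm (lam j \<xi> - (\<i> * of_real (norm \<xi>) * b + of_real (norm \<xi>) ^ 2 *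
          (poly (hom_symbol c (r + 1) (cvec \<xi>')) b / poly (hom_symbol c r (cvec \<xi>') div [:- b, 1:]) b)))
          \<le> C * norm \<xi> ^ 3"
        unfolding check lam(1)[OF j] using F(3)[of \<xi> j] \<xi> j
        by (simp add: Let_def b_def \<xi>'_def)
      also have "\<dots> = C * norm \<xi> * norm \<xi> ^ 2" by (simp add: power2_eq_square power3_eq_cube)
      also have "\<dots> \<le> e * norm \<xi> ^ 2"
        using \<xi> C(1) by (intro mult_right_mono) (auto simp: field_simps)
      finally show "norm (let \<xi>' = \<xi> /\<^sub>R norm \<xi>; b = complex_of_real (\<beta> j \<xi>') in
                 lam j \<xi> - (\<i> * of_real (norm \<xi>) * b
                   + of_real (norm \<xi>) ^ 2
                     * (poly (hom_symbol c (r + 1) (cvec \<xi>')) b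
                        / poly (hom_symbol c r (cvec \<xi>') div [:- b, 1:]) b)))
           \<le> e * norm (complex_of_real (norm \<xi>) ^ 2)"
        by (simp add: Let_def b_def \<xi>'_def norm_power)
    qed
  qed
  ultimately show ?thesis
    using lam(2,3) unfolding Q_def G_def r_def by blast
qed

end
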